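(* Let $\mathbf{X}\sim\mathcal{N}(\mathbf{0}_n,\mathbf{I}_n)$ and $\mathbf{Y}|\mathbf{X}=\mathbf{x}\sim\mathcal{N}(\mathbf{x},\sigma^2\mathbf{I}_n)$ with $\sigma>0$. Then $$\mathrm{mmse}(\vec{\mathbf{X}}|\vec{\mathbf{Y}})\ge\frac{1}{(n!)^{2/n}}\,\mathrm{mmse}(\mathbf{X}|\mathbf{Y}),\qquad\text{where }\mathrm{mmse}(\mathbf{X}|\mathbf{Y})=n\frac{\sigma^2}{1+\sigma^2}.$$ Moreover, as $\sigma\to\infty$ this bound reduces to $$\mathsf{Var}(\vec{\mathbf{X}})\ge\frac{n}{2\pi e}e^{\frac{2}{n}h(\vec{\mathbf{X}})}=\frac{n}{(n!)^{2/n}}.$$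
   Context: $\vec{\mathbf{X}},\vec{\mathbf{Y}}$ are $\mathbf{X},\mathbf{Y}$ with entries sorted in ascending order. For random vectors $\mathbf{V},\mathbf{U}$, $\mathrm{mmse}(\mathbf{V}|\mathbf{U})=\mathbb{E}\left[\|\mathbf{V}-\mathbb{E}[\mathbf{V}|\mathbf{U}]\|^2\right]$ and $\mathsf{Var}(\mathbf{V})=\mathbb{E}\left[\|\mathbf{V}-\mathbb{E}[\mathbf{V}]\|^2\right]$, with $\|\cdot\|$ the Euclidean norm. $h(\vec{\mathbf{X}})$ is the differential entropy (natural logarithm) of $\vec{\mathbf{X}}$. *)

theory Defs
  imports "HOL-Probability.Probability"
begin

text \<open>Random vectors in R^n are modelled as maps  V :: 'a \<Rightarrow> nat \<Rightarrow> real,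
  where only the coordinates 0..n-1 are relevant.\<close>

text \<open>Vector with entries sorted in ascending order (as an element of the
  n-fold product space, i.e. extensional on {..<n}).\<close>
definition sortvec :: "nat \<Rightarrow> (nat \<Rightarrow> real) \<Rightarrow> (nat \<Rightarrow> real)" where
  "sortvec n x = (\<lambda>i\<in>{..<n}. sort (map x [0..<n]) ! i)"

definition gen_sigma :: "'a measure \<Rightarrow> nat \<Rightarrow> ('a \<Rightarrow> nat \<Rightarrow> real) \<Rightarrow> 'a measure" where
  "gen_sigma M n U = sigma (space M)
     {(\<lambda>\<omega>. U \<omega> i) -` B \<inter> space M | i B. i < n \<and> B \<in> sets borel}"

definition mmse :: "'a measure \<Rightarrow> nat \<Rightarrow> ('a \<Rightarrow> nat \<Rightarrow> real) \<Rightarrow> ('a \<Rightarrow> nat \<Rightarrow> real) \<Rightarrow> real" where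
  "mmse M n V U = (\<integral>\<omega>. (\<Sum>i<n. (V \<omega> i - real_cond_exp M (gen_sigma M n U) (\<lambda>\<eta>. V \<eta> i) \<omega>)\<^sup>2) \<partial>M)"

definition vvar :: "'a measure \<Rightarrow> nat \<Rightarrow> ('a \<Rightarrow> nat \<Rightarrow> real) \<Rightarrow> real" where
  "vvar M n V = (\<integral>\<omega>. (\<Sum>i<n. (V \<omega> i - (\<integral>\<eta>. V \<eta> i \<partial>M))\<^sup>2) \<partial>M)"

definition diff_entropy :: "'a measure \<Rightarrow> nat \<Rightarrow> ('a \<Rightarrow> nat \<Rightarrow> real) \<Rightarrow> real" where
  "diff_entropy M n V = prob_space.entropy M (exp 1) (PiM {..<n} (\<lambda>_. lborel)) V"

end

theory Submission
  imports Defs "HOL-Combinatorics.Permutations" "HOL-Real_Asymp.Real_Asymp"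
begin

text \<open>
  Put \<open>Y = X + \<sigma> Z\<close> and \<open>W = X - Y / (1 + \<sigma>\<^sup>2)\<close>. The residual \<open>W\<close> is independent of \<open>Y\<close> with independent
  \<open>N(0, s\<^sup>2)\<close> entries, \<open>s\<^sup>2 = \<sigma>\<^sup>2 / (1 + \<sigma>\<^sup>2)\<close>, which gives the unsorted error. For an estimator \<open>g\<close> of
  the sorted vector, compare the Gaussian law \<open>N(g, t\<^sup>2 I)\<close>, evaluated at sorted \<open>X\<close>, with the conditional
  density of \<open>X\<close> given \<open>Y\<close>. Their ratio has expectation at most \<open>n!\<close>, because the value of a
  nonnegative function at the sorted vector is at most the sum of its values over all permuted
  vectors; Jensen's inequality for the logarithm, with \<open>t\<^sup>2 = s\<^sup>2 / (n!)\<^bsup>2/n\<^esup>\<close>, is the lower bound.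

  For the limit, sorting is 1-Lipschitz in the maximum norm, so sorted \<open>X\<close> differs from sorted \<open>W\<close>, which is
  independent of \<open>Y\<close>, by \<open>O(1/\<sigma>)\<close> in mean square; hence conditioning on \<open>Y\<close> reduces the variance only
  by \<open>O(1/\<sigma>\<^sup>2)\<close>. The entropy is computed from the density \<open>n! \<Prod> \<phi>(x i)\<close> on strictly increasing vectors.
\<close>

section \<open>Sorting vectors\<close>

text \<open>In a sorted list the positions holding values at most \<open>t\<close> form an initial
  segment, so comparing one entry with \<open>t\<close> amounts to counting the small
  entries.\<close>

lemma sorted_nth_le_iff:
  fixes ys :: "real list"
  assumes "sorted ys" "i < length ys"
  shows "ys ! i \<le> t \<longleftrightarrow> i < length (filter (\<lambda>y. y \<le> t) ys)"
proof -
  let ?S = "{j. j < length ys \<and> ys ! j \<le> t}"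
  have len: "length (filter (\<lambda>y. y \<le> t) ys) = card ?S"
    by (rule length_filter_conv_card)
  show ?thesis
  proof
    assume "ys ! i \<le> t"
    then have "{..i} \<subseteq> ?S"
      using assms by (auto intro: order_trans[OF sorted_nth_mono])
    then have "card {..i} \<le> card ?S" by (intro card_mono) auto
    then show "i < length (filter (\<lambda>y. y \<le> t) ys)" unfolding len by simp
  next
    assume i: "i < length (filter (\<lambda>y. y \<le> t) ys)"
    show "ys ! i \<le> t"
    proof (rule ccontr)
      assume "\<not> ys ! i \<le> t"
      then have "?S \<subseteq> {..<i}"
        using assms by (auto simp: not_le intro: ccontr dest: sorted_nth_mono[of ys i])
          (meson leI order.strict_trans2 order_less_irrefl sorted_nth_mono)
      then have "card ?S \<le> card {..<i}" by (intro card_mono) auto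
      with i show False unfolding len by simp
    qed
  qed
qed

lemma sortvec_cong:
  assumes "\<And>j. j < n \<Longrightarrow> x j = y j"
  shows "sortvec n x = sortvec n y"
proof -
  have "map x [0..<n] = map y [0..<n]" using assms by simp
  then show ?thesis by (simp only: sortvec_def)
qed

text \<open>Counting entries below a threshold does not depend on their order, which frees order
  statistics from the sorting permutation. Measurability and the Lipschitz bound both rest on this
  form.\<close>

lemma sortvec_le_iff:
  assumes "i < n"
  shows "sortvec n x i \<le> t \<longleftrightarrow> i < card {j. j < n \<and> x j \<le> t}"
proof -
  have "length (filter (\<lambda>y. y \<le> t) (sort (map x [0..<n]))) = length (filter (\<lambda>y. y \<le> t) (map x [0..<n]))"
    by (metis mset_filter mset_sort size_mset)
  also have "\<dots> = card {j. j < n \<and> x j \<le> t}"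
    unfolding length_filter_conv_card by (intro arg_cong[where f=card]) auto
  finally show ?thesis
    using assms sorted_nth_le_iff[of "sort (map x [0..<n])" i t] by (simp add: sortvec_def)
qed

text \<open>The counting criterion compares thresholds directly, so no matching between the two
  sorting permutations has to be built.\<close>

lemma sortvec_lipschitz:
  assumes "i < n" and "\<And>j. j < n \<Longrightarrow> \<bar>x j - y j\<bar> \<le> d"
  shows "\<bar>sortvec n x i - sortvec n y i\<bar> \<le> d"
proof -
  have *: "sortvec n u i \<le> sortvec n v i + d" if "\<And>j. j < n \<Longrightarrow> u j \<le> v j + d" for u v
  proof -
    \<comment> \<open>More than \<open>i\<close> entries of \<open>v\<close> lie at or below
      \<open>sortvec n v i\<close>; at the same indices \<open>u\<close> lies at or below this
      threshold raised by \<open>d\<close>.\<close>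
    have "i < card {j. j < n \<and> v j \<le> sortvec n v i}"
      using sortvec_le_iff[OF assms(1), of v "sortvec n v i"] by simp
    also have "\<dots> \<le> card {j. j < n \<and> u j \<le> sortvec n v i + d}"
      using that by (intro card_mono) (auto, force)
    finally show ?thesis
      using sortvec_le_iff[OF assms(1)] by simp
  qed
  show ?thesis
    using *[of x y] *[of y x] assms(2) by (auto simp: abs_le_iff) (smt (verit))+
qed

text \<open>The permutation depends on \<open>x\<close>, and no measurable choice of it is claimed:
  it serves pointwise, to bound or rewrite expressions.\<close>

lemma sortvec_eq_permute:
  obtains p where "p permutes {..<n}" "\<And>i. i < n \<Longrightarrow> sortvec n x i = x (p i)"
proof -
  obtain p where p: "p permutes {..<length (map x [0..<n])}"
      "permute_list p (map x [0..<n]) = sort (map x [0..<n])"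
    using mset_eq_permutation[of "sort (map x [0..<n])" "map x [0..<n]"] by auto
  have "sortvec n x i = x (p i)" if "i < n" for i
  proof -
    have "p i < n" using p(1) that permutes_in_image[of p "{..<n}" i] by simp
    then show ?thesis
      using permute_list_nth[OF p(1), of i] that by (simp add: sortvec_def flip: p(2))
  qed
  with p(1) that show ?thesis by simp
qed

text \<open>A monotone rearrangement has the same multiset as the sorted list, hence equals it. Ties
  may make \<open>p\<close> ambiguous, but not the values.\<close>

lemma sortvec_unique:
  assumes p: "p permutes {..<n}" and mono: "\<And>i j. i < j \<Longrightarrow> j < n \<Longrightarrow> x (p i) \<le> x (p j)"
    and "i < n"
  shows "sortvec n x i = x (p i)"
proof -
  let ?ys = "permute_list p (map x [0..<n])"
  have pn: "p i < n" if "i < n" for i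
    using p that permutes_in_image[of p "{..<n}" i] by simp
  have nth: "?ys ! i = x (p i)" if "i < n" for i
    using p that pn[OF that] by (simp add: permute_list_nth)
  have "sorted ?ys"
    unfolding sorted_iff_nth_mono_less using mono nth by auto
  moreover have "mset ?ys = mset (map x [0..<n])"
    using p by (intro mset_permute_list) simp
  ultimately have "sort (map x [0..<n]) = ?ys"
    by (intro properties_for_sort)
  then show ?thesis using nth assms(3) by (simp add: sortvec_def)
qed

text \<open>Sublevel sets are events about a count, and the count is a finite sum of indicators of
  measurable events.\<close>

lemma measurable_sortvec_component[measurable]:
  assumes "i < n" and [measurable]: "\<And>j. j < n \<Longrightarrow> (\<lambda>\<omega>. x \<omega> j) \<in> borel_measurable M"
  shows "(\<lambda>\<omega>. sortvec n (x \<omega>) i) \<in> borel_measurable M"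
proof (rule borel_measurable_iff_le[THEN iffD2], rule allI)
  fix t
  have "card {j. j < n \<and> x \<omega> j \<le> t} = (\<Sum>j\<in>{..<n}. if x \<omega> j \<le> t then 1 else 0)" for \<omega>
    by (subst sum.If_cases) (auto intro!: arg_cong[where f=card])
  then have "{\<omega> \<in> space M. sortvec n (x \<omega>) i \<le> t}
      = {\<omega> \<in> space M. i < (\<Sum>j\<in>{..<n}. if x \<omega> j \<le> t then 1 else 0 :: nat)}"
    by (simp add: sortvec_le_iff[OF assms(1)])
  also have "\<dots> \<in> sets M"
    by measurable
  finally show "{\<omega> \<in> space M. sortvec n (x \<omega>) i \<le> t} \<in> sets M" .
qed

lemma sortvec_extensional: "i \<ge> n \<Longrightarrow> sortvec n x i = undefined"
  by (simp add: sortvec_def)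

text \<open>Sorting only permutes the summands. With the square for \<open>f\<close> this gives the
  domination of order statistics and the quadratic term of the entropy.\<close>

lemma sum_sortvec:
  "(\<Sum>i<n. f (sortvec n x i)) = (\<Sum>i<n. f (x i))"
proof -
  obtain p where p: "p permutes {..<n}" "\<And>i. i < n \<Longrightarrow> sortvec n x i = x (p i)"
    by (rule sortvec_eq_permute[of n x]) blast
  have "(\<Sum>i<n. f (sortvec n x i)) = (\<Sum>i<n. f (x (p i)))" using p(2) by simp
  also have "\<dots> = (\<Sum>i<n. f (x i))"
    using sum.permute[OF p(1), of "\<lambda>i. f (x i)"] by (simp add: comp_def)
  finally show ?thesis .
qed

section \<open>Rotation of a Gaussian pair\<close>

text \<open>The substitution \<open>x = y / (1 + \<sigma>\<^sup>2) + w\<close>,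
  \<open>z = (y - x) / \<sigma>\<close> turns the exponent into a square in \<open>w\<close> plus a
  square in \<open>y\<close>: the density form of independence of residual and observation. The
  factor \<open>1 / \<sigma>\<close> is the Jacobian.\<close>

lemma normal_density_rotation:
  fixes \<sigma> w y :: real
  assumes "\<sigma> > 0"
  defines "r \<equiv> sqrt (1 + \<sigma>\<^sup>2)"
  shows "1 / \<sigma> * (std_normal_density (y / (1 + \<sigma>\<^sup>2) + w) * std_normal_density (- ((y / (1 + \<sigma>\<^sup>2) + w) / \<sigma>) + 1 / \<sigma> * y))
    = normal_density 0 (\<sigma> / r) w * normal_density 0 r y"
proof -
  have r2: "r\<^sup>2 = 1 + \<sigma>\<^sup>2" and r: "r > 0"
    unfolding r_def by (simp_all add: add_pos_nonneg)
  \<comment> \<open>Completing the square: the coefficient \<open>1 / (1 + \<sigma>\<^sup>2)\<close>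
    is the one for which the mixed terms in \<open>w\<close> and \<open>y\<close> cancel.\<close>
  have e: "- (y / (1 + \<sigma>\<^sup>2) + w)\<^sup>2 / 2 + - (- ((y / (1 + \<sigma>\<^sup>2) + w) / \<sigma>) + 1 / \<sigma> * y)\<^sup>2 / 2
      = - w\<^sup>2 / (2 * (\<sigma> / r)\<^sup>2) + - y\<^sup>2 / (2 * r\<^sup>2)"
  proof -
    have "1 + \<sigma>\<^sup>2 \<noteq> 0" using r2 r by (metis less_irrefl zero_less_power)
    then show ?thesis
      unfolding power_divide r2 using assms(1)
      by (simp add: divide_simps) algebra
  qed
  \<comment> \<open>The new standard deviations multiply to
    \<open>\<sigma> / r * r = \<sigma>\<close>, which the Jacobian absorbs.\<close>
  have "sqrt (2 * pi * (\<sigma> / r)\<^sup>2) * sqrt (2 * pi * r\<^sup>2) = \<sigma> * (sqrt (2 * pi) * sqrt (2 * pi))"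
    using assms(1) r by (simp add: real_sqrt_mult)
  then have k: "1 / \<sigma> * (1 / sqrt (2 * pi) * (1 / sqrt (2 * pi)))
      = 1 / sqrt (2 * pi * (\<sigma> / r)\<^sup>2) * (1 / sqrt (2 * pi * r\<^sup>2))"
    by (metis mult.assoc mult_1 times_divide_times_eq)
  have "1 / \<sigma> * (std_normal_density (y / (1 + \<sigma>\<^sup>2) + w) * std_normal_density (- ((y / (1 + \<sigma>\<^sup>2) + w) / \<sigma>) + 1 / \<sigma> * y))
    = (1 / \<sigma> * (1 / sqrt (2 * pi) * (1 / sqrt (2 * pi)))) *
      exp (- (y / (1 + \<sigma>\<^sup>2) + w)\<^sup>2 / 2 + - (- ((y / (1 + \<sigma>\<^sup>2) + w) / \<sigma>) + 1 / \<sigma> * y)\<^sup>2 / 2)"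
    unfolding std_normal_density_def exp_add by (simp only: mult_ac)
  also have "\<dots> = normal_density 0 (\<sigma> / r) w * normal_density 0 r y"
    unfolding k e unfolding normal_density_def exp_add by simp
  finally show ?thesis .
qed

text \<open>The planar change of variables is done as two one-dimensional ones with Fubini between
  them: first \<open>z\<close> to \<open>y\<close> at fixed \<open>x\<close>, then \<open>x\<close>
  to \<open>w\<close> at fixed \<open>y\<close>. The integrand then splits into a product.\<close>

lemma (in prob_space) emeasure_gaussian_rotation:
  fixes X Z :: "'a \<Rightarrow> real"
  assumes ind: "indep_var borel X borel Z" and \<sigma>: "\<sigma> > 0"
    and X: "distributed M lborel X (\<lambda>x. ennreal (std_normal_density x))"
    and Z: "distributed M lborel Z (\<lambda>x. ennreal (std_normal_density x))"
    and [measurable]: "A \<in> sets borel" "B \<in> sets borel"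
  defines "r \<equiv> sqrt (1 + \<sigma>\<^sup>2)"
  shows "emeasure M {\<omega> \<in> space M. X \<omega> - (X \<omega> + \<sigma> * Z \<omega>) / (1 + \<sigma>\<^sup>2) \<in> A \<and> X \<omega> + \<sigma> * Z \<omega> \<in> B}
    = (\<integral>\<^sup>+w. ennreal (normal_density 0 (\<sigma> / r) w) * indicator A w \<partial>lborel) *
      (\<integral>\<^sup>+y. ennreal (normal_density 0 r y) * indicator B y \<partial>lborel)"
proof -
  define c where "c = 1 / (1 + \<sigma>\<^sup>2)"
  have [measurable]: "X \<in> borel_measurable M" "Z \<in> borel_measurable M"
    using distributed_measurable[OF X] distributed_measurable[OF Z] by simp_all
  have ind': "indep_var lborel X lborel Z"
    using ind unfolding indep_var_eq by simp
  have J: "distributed M (lborel \<Otimes>\<^sub>M lborel) (\<lambda>\<omega>. (X \<omega>, Z \<omega>))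
      (\<lambda>(x, z). ennreal (std_normal_density x) * ennreal (std_normal_density z))"
    using distributed_joint_indep[OF _ _ X Z ind'] by (simp add: lborel.sigma_finite_measure_axioms)
  define g where "g = (\<lambda>(x::real, z::real). indicator A (x - c * (x + \<sigma> * z)) * (indicator B (x + \<sigma> * z) :: ennreal))"
  have [measurable]: "g \<in> borel_measurable (lborel \<Otimes>\<^sub>M lborel)"
    unfolding g_def by measurable
  have "emeasure M {\<omega> \<in> space M. X \<omega> - (X \<omega> + \<sigma> * Z \<omega>) / (1 + \<sigma>\<^sup>2) \<in> A \<and> X \<omega> + \<sigma> * Z \<omega> \<in> B}
      = (\<integral>\<^sup>+\<omega>. g (X \<omega>, Z \<omega>) \<partial>M)"
  proof -
    let ?S = "{\<omega> \<in> space M. X \<omega> - (X \<omega> + \<sigma> * Z \<omega>) / (1 + \<sigma>\<^sup>2) \<in> A \<and> X \<omega> + \<sigma> * Z \<omega> \<in> B}"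
    have "emeasure M ?S = (\<integral>\<^sup>+\<omega>. indicator ?S \<omega> \<partial>M)"
      by (rule nn_integral_indicator[symmetric]) measurable
    also have "\<dots> = (\<integral>\<^sup>+\<omega>. g (X \<omega>, Z \<omega>) \<partial>M)"
      by (intro nn_integral_cong) (auto simp: g_def c_def split: split_indicator)
    finally show ?thesis .
  qed
  also have "\<dots> = (\<integral>\<^sup>+p. (case p of (x, z) \<Rightarrow> ennreal (std_normal_density x) * ennreal (std_normal_density z)) * g p \<partial>(lborel \<Otimes>\<^sub>M lborel))"
    by (subst distributed_nn_integral[OF J]) auto
  also have "\<dots> = (\<integral>\<^sup>+x. \<integral>\<^sup>+z. ennreal (std_normal_density x) * ennreal (std_normal_density z) * g (x, z) \<partial>lborel \<partial>lborel)"
    by (subst lborel.nn_integral_fst[symmetric]) auto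
  \<comment> \<open>Here \<open>x + \<sigma> * z\<close> becomes \<open>y\<close>; the scaling
    contributes \<open>1 / \<sigma>\<close>.\<close>
  also have "\<dots> = (\<integral>\<^sup>+x. \<integral>\<^sup>+y. ennreal (1 / \<sigma>) * (ennreal (std_normal_density x) * ennreal (std_normal_density (- (x / \<sigma>) + 1 / \<sigma> * y))
        * (indicator A (x - c * y) * indicator B y)) \<partial>lborel \<partial>lborel)"
  proof (rule nn_integral_cong)
    fix x :: real
    have eq: "g (x, - (x / \<sigma>) + 1 / \<sigma> * y) = indicator A (x - c * y) * indicator B y" for y
    proof -
      have "x + \<sigma> * (- (x / \<sigma>) + 1 / \<sigma> * y) = y" using \<sigma> by (simp add: field_simps)
      then show ?thesis by (simp add: g_def)
    qed
    show "(\<integral>\<^sup>+z. ennreal (std_normal_density x) * ennreal (std_normal_density z) * g (x, z) \<partial>lborel)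
      = (\<integral>\<^sup>+y. ennreal (1 / \<sigma>) * (ennreal (std_normal_density x) * ennreal (std_normal_density (- (x / \<sigma>) + 1 / \<sigma> * y))
        * (indicator A (x - c * y) * indicator B y)) \<partial>lborel)"
      using \<sigma> by (subst nn_integral_real_affine[where c="1/\<sigma>" and t="- (x / \<sigma>)"])
        (auto simp: nn_integral_cmult eq[simplified])
  qed
  also have "\<dots> = (\<integral>\<^sup>+y. \<integral>\<^sup>+x. ennreal (1 / \<sigma>) * (ennreal (std_normal_density x) * ennreal (std_normal_density (- (x / \<sigma>) + 1 / \<sigma> * y))
        * (indicator A (x - c * y) * indicator B y)) \<partial>lborel \<partial>lborel)"
    by (rule lborel_pair.Fubini'[symmetric]) measurable
  \<comment> \<open>Here \<open>x\<close> is shifted by \<open>c * y\<close>, a translation with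
    Jacobian one, and the rotated density factorizes.\<close>
  also have "\<dots> = (\<integral>\<^sup>+y. \<integral>\<^sup>+w. (ennreal (normal_density 0 (\<sigma> / r) w) * indicator A w) * (ennreal (normal_density 0 r y) * indicator B y) \<partial>lborel \<partial>lborel)"
  proof (rule nn_integral_cong)
    fix y :: real
    have eq: "ennreal (1 / \<sigma>) * (ennreal (std_normal_density (c * y + w)) * ennreal (std_normal_density (- ((c * y + w) / \<sigma>) + 1 / \<sigma> * y))
        * (indicator A w * indicator B y))
      = (ennreal (normal_density 0 (\<sigma> / r) w) * indicator A w) * (ennreal (normal_density 0 r y) * indicator B y)" for w
    proof -
      have cy: "y / (1 + \<sigma>\<^sup>2) = c * y" by (simp add: c_def)
      have "ennreal (1 / \<sigma>) * (ennreal (std_normal_density (c * y + w)) * ennreal (std_normal_density (- ((c * y + w) / \<sigma>) + 1 / \<sigma> * y)))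
        = ennreal (normal_density 0 (\<sigma> / r) w) * ennreal (normal_density 0 r y)"
        using normal_density_rotation[OF \<sigma>, of y w] \<sigma> unfolding cy r_def
        by (simp add: ennreal_mult[symmetric])
      then show ?thesis by (simp only: mult_ac)
    qed
    show "(\<integral>\<^sup>+x. ennreal (1 / \<sigma>) * (ennreal (std_normal_density x) * ennreal (std_normal_density (- (x / \<sigma>) + 1 / \<sigma> * y))
        * (indicator A (x - c * y) * indicator B y)) \<partial>lborel)
     = (\<integral>\<^sup>+w. (ennreal (normal_density 0 (\<sigma> / r) w) * indicator A w) * (ennreal (normal_density 0 r y) * indicator B y) \<partial>lborel)"
      by (subst nn_integral_real_affine[where c=1 and t="c * y"]) (auto simp: eq[simplified])
  qed
  also have "\<dots> = (\<integral>\<^sup>+y. (\<integral>\<^sup>+w. ennreal (normal_density 0 (\<sigma> / r) w) * indicator A w \<partial>lborel) * (ennreal (normal_density 0 r y) * indicator B y) \<partial>lborel)"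
    by (intro nn_integral_cong nn_integral_multc) measurable
  also have "\<dots> = (\<integral>\<^sup>+w. ennreal (normal_density 0 (\<sigma> / r) w) * indicator A w \<partial>lborel) *
      (\<integral>\<^sup>+y. ennreal (normal_density 0 r y) * indicator B y \<partial>lborel)"
    by (intro nn_integral_cmult) measurable
  finally show ?thesis .
qed

text \<open>Each marginal comes from the product formula with the other set taken to be the whole
  line; inserting the marginals back gives the independence.\<close>

lemma (in prob_space)
  fixes X Z :: "'a \<Rightarrow> real"
  assumes ind: "indep_var borel X borel Z" and \<sigma>: "\<sigma> > 0"
    and X: "distributed M lborel X (\<lambda>x. ennreal (std_normal_density x))"
    and Z: "distributed M lborel Z (\<lambda>x. ennreal (std_normal_density x))"
  defines "W \<equiv> (\<lambda>\<omega>. X \<omega> - (X \<omega> + \<sigma> * Z \<omega>) / (1 + \<sigma>\<^sup>2))" and "Y \<equiv> (\<lambda>\<omega>. X \<omega> + \<sigma> * Z \<omega>)"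
  shows distributed_gaussian_residual:
      "distributed M lborel W (\<lambda>x. ennreal (normal_density 0 (\<sigma> / sqrt (1 + \<sigma>\<^sup>2)) x))"
    and distributed_gaussian_observation:
      "distributed M lborel Y (\<lambda>x. ennreal (normal_density 0 (sqrt (1 + \<sigma>\<^sup>2)) x))"
    and prob_residual_observation: "A \<in> sets borel \<Longrightarrow> B \<in> sets borel \<Longrightarrow>
      prob {\<omega> \<in> space M. W \<omega> \<in> A \<and> Y \<omega> \<in> B}
      = prob (W -` A \<inter> space M) * prob (Y -` B \<inter> space M)"
proof -
  have [measurable]: "X \<in> borel_measurable M" "Z \<in> borel_measurable M"
    using distributed_measurable[OF X] distributed_measurable[OF Z] by simp_all
  have [measurable]: "W \<in> borel_measurable M" "Y \<in> borel_measurable M"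
    unfolding W_def Y_def by measurable
  let ?r = "sqrt (1 + \<sigma>\<^sup>2)"
  have r: "?r > 0" by (simp add: add_pos_nonneg)
  have one: "(\<integral>\<^sup>+y. ennreal (normal_density 0 s y) * indicator UNIV y \<partial>lborel) = 1" if "s > 0" for s
    using that by (simp add: nn_integral_eq_integral)
  note rot = emeasure_gaussian_rotation[OF ind \<sigma> X Z, folded W_def Y_def]
  have *: "emeasure M {\<omega> \<in> space M. W \<omega> \<in> A \<and> Y \<omega> \<in> B}
    = (\<integral>\<^sup>+w. ennreal (normal_density 0 (\<sigma> / ?r) w) * indicator A w \<partial>lborel) *
      (\<integral>\<^sup>+y. ennreal (normal_density 0 ?r y) * indicator B y \<partial>lborel)"
    if "A \<in> sets borel" "B \<in> sets borel" for A B
    using rot[OF that] by (simp add: W_def Y_def)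
  have W: "emeasure M (W -` A \<inter> space M) = (\<integral>\<^sup>+w. ennreal (normal_density 0 (\<sigma> / ?r) w) * indicator A w \<partial>lborel)"
    if "A \<in> sets borel" for A
  proof -
    have "W -` A \<inter> space M = {\<omega> \<in> space M. W \<omega> \<in> A \<and> Y \<omega> \<in> UNIV}" by auto
    then show ?thesis using *[OF that, of UNIV] one[OF r] by simp
  qed
  have Y: "emeasure M (Y -` A \<inter> space M) = (\<integral>\<^sup>+w. ennreal (normal_density 0 ?r w) * indicator A w \<partial>lborel)"
    if "A \<in> sets borel" for A
  proof -
    have "Y -` A \<inter> space M = {\<omega> \<in> space M. W \<omega> \<in> UNIV \<and> Y \<omega> \<in> A}" by auto
    moreover have "0 < \<sigma> / ?r" using r \<sigma> by simp
    ultimately show ?thesis using *[OF _ that, of UNIV] one[of "\<sigma> / ?r"] by simp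
  qed
  show "distributed M lborel W (\<lambda>x. ennreal (normal_density 0 (\<sigma> / ?r) x))"
    unfolding distributed_def by (auto intro!: measure_eqI simp: emeasure_distr emeasure_density W)
  show "distributed M lborel Y (\<lambda>x. ennreal (normal_density 0 ?r x))"
    unfolding distributed_def by (auto intro!: measure_eqI simp: emeasure_distr emeasure_density Y)
  show "prob {\<omega> \<in> space M. W \<omega> \<in> A \<and> Y \<omega> \<in> B}
      = prob (W -` A \<inter> space M) * prob (Y -` B \<inter> space M)"
    if "A \<in> sets borel" "B \<in> sets borel"
    using *[OF that] W[OF that(1)] Y[OF that(2)]
    by (simp add: measure_def enn2real_mult)
qed

section \<open>Independence\<close>

lemma (in prob_space) indep_var_pair_of_indep_vars:
  assumes "indep_vars (\<lambda>_. N) U J" "i \<in> J" "j \<in> J" "i \<noteq> j"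
  shows "indep_var N (U i) N (U j)"
proof -
  have "indep_var (PiM {i} (\<lambda>_. N)) (\<lambda>\<omega>. restrict (\<lambda>k. U k \<omega>) {i})
      (PiM {j} (\<lambda>_. N)) (\<lambda>\<omega>. restrict (\<lambda>k. U k \<omega>) {j})"
    using assms by (intro indep_var_restrict[of _ _ J]) auto
  then have "indep_var N ((\<lambda>f. f i) \<circ> (\<lambda>\<omega>. restrict (\<lambda>k. U k \<omega>) {i}))
      N ((\<lambda>f. f j) \<circ> (\<lambda>\<omega>. restrict (\<lambda>k. U k \<omega>) {j}))"
    by (rule indep_var_compose) auto
  then show ?thesis by (simp add: comp_def)
qed

text \<open>The blocks \<open>{Inl i, Inr i}\<close> are disjoint, and functions of disjoint blocks
  of independent variables are independent.\<close>

lemma (in prob_space) indep_vars_pairing: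
  assumes "indep_vars (\<lambda>_. N) (\<lambda>k. case k of Inl i \<Rightarrow> X i | Inr i \<Rightarrow> Z i) (Inl ` I \<union> Inr ` I)"
  shows "indep_vars (\<lambda>_. N \<Otimes>\<^sub>M N) (\<lambda>i \<omega>. (X i \<omega>, Z i \<omega>)) I"
proof -
  let ?U = "\<lambda>k. case k of Inl i \<Rightarrow> X i | Inr i \<Rightarrow> Z i"
  have "indep_vars (\<lambda>i. PiM {Inl i, Inr i} (\<lambda>_. N)) (\<lambda>i \<omega>. restrict (\<lambda>k. ?U k \<omega>) {Inl i, Inr i}) I"
    by (rule indep_vars_restrict[OF assms]) (auto simp: disjoint_family_on_def)
  then have "indep_vars (\<lambda>_. N \<Otimes>\<^sub>M N)
      (\<lambda>i \<omega>. (\<lambda>f. (f (Inl i), f (Inr i))) (restrict (\<lambda>k. ?U k \<omega>) {Inl i, Inr i})) I"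
    by (rule indep_vars_compose2) auto
  then show ?thesis by simp
qed

text \<open>Independence across indices and within each pair combine to joint independence of all
  coordinates over a sum-type index; regrouping by constructor yields two independent
  vectors.\<close>

lemma (in prob_space) indep_vars_split_pairs:
  fixes W Y :: "nat \<Rightarrow> 'a \<Rightarrow> real"
  assumes ind: "indep_vars (\<lambda>_. borel \<Otimes>\<^sub>M borel) (\<lambda>i \<omega>. (W i \<omega>, Y i \<omega>)) I"
    and I: "finite I" "I \<noteq> {}"
    and prod: "\<And>i A B. i \<in> I \<Longrightarrow> A \<in> sets borel \<Longrightarrow> B \<in> sets borel \<Longrightarrow>
      prob {\<omega> \<in> space M. W i \<omega> \<in> A \<and> Y i \<omega> \<in> B}
      = prob (W i -` A \<inter> space M) * prob (Y i -` B \<inter> space M)"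
  shows "indep_var (PiM I (\<lambda>_. borel)) (\<lambda>\<omega>. \<lambda>i\<in>I. W i \<omega>) (PiM I (\<lambda>_. borel)) (\<lambda>\<omega>. \<lambda>i\<in>I. Y i \<omega>)"
proof -
  let ?U = "\<lambda>k. case k of Inl i \<Rightarrow> W i | Inr i \<Rightarrow> Y i"
  let ?J = "Inl ` I \<union> Inr ` I :: (nat + nat) set"
  have rv: "random_variable (borel \<Otimes>\<^sub>M borel) (\<lambda>\<omega>. (W i \<omega>, Y i \<omega>))" if "i \<in> I" for i
    using ind that by (auto simp: indep_vars_def)
  have WY: "W i \<in> borel_measurable M" "Y i \<in> borel_measurable M" if "i \<in> I" for i
    using measurable_compose[OF rv[OF that] measurable_fst] measurable_compose[OF rv[OF that] measurable_snd]
    by simp_all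
  \<comment> \<open>The Borel sets are intersection-stable and contain the whole space, so the
    product formula need only be checked over the full finite index set, not over its
    subsets.\<close>
  have "indep_vars (\<lambda>_. borel) ?U ?J \<longleftrightarrow>
    (\<forall>A\<in>(\<Pi> k\<in>?J. sets borel). prob (\<Inter>k\<in>?J. ?U k -` A k \<inter> space M) = (\<Prod>k\<in>?J. prob (?U k -` A k \<inter> space M)))"
  proof (rule indep_vars_finite)
    show "?J \<noteq> {}" "finite ?J" using I by auto
    show "sets borel = sigma_sets (space borel) (sets (borel :: real measure))"
      by (rule sets.sigma_sets_eq[symmetric])
    show "random_variable borel (?U k)" if "k \<in> ?J" for k using that WY by auto
    show "Int_stable (sets (borel :: real measure))" by (rule sets.Int_stable)
    show "space borel \<in> sets (borel :: real measure)" by (rule sets.top)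
    show "sets (borel :: real measure) \<subseteq> Pow (space borel)" by (rule sets.space_closed)
  qed
  moreover have "prob (\<Inter>k\<in>?J. ?U k -` A k \<inter> space M) = (\<Prod>k\<in>?J. prob (?U k -` A k \<inter> space M))"
    if A: "A \<in> (\<Pi> k\<in>?J. sets borel)" for A
  proof -
    have A': "A (Inl i) \<in> sets borel" "A (Inr i) \<in> sets borel" if "i \<in> I" for i
      using A that by auto
    have eq: "(\<lambda>\<omega>. (W i \<omega>, Y i \<omega>)) -` (A (Inl i) \<times> A (Inr i)) \<inter> space M
        = {\<omega> \<in> space M. W i \<omega> \<in> A (Inl i) \<and> Y i \<omega> \<in> A (Inr i)}" for i by auto
    have J: "?J \<noteq> {}" using I(2) by simp
    have "(\<Inter>k\<in>?J. ?U k -` A k \<inter> space M) = {\<omega> \<in> space M. \<forall>k\<in>?J. ?U k \<omega> \<in> A k}"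
      using J by blast
    also have "\<dots> = {\<omega> \<in> space M. \<forall>i\<in>I. W i \<omega> \<in> A (Inl i) \<and> Y i \<omega> \<in> A (Inr i)}"
      unfolding ball_Un by (simp add: ball_conj_distrib)
    \<comment> \<open>Each pair of events becomes a rectangle for the paired variable, to which
      independence across indices applies.\<close>
    also have "\<dots> = (\<Inter>i\<in>I. (\<lambda>\<omega>. (W i \<omega>, Y i \<omega>)) -` (A (Inl i) \<times> A (Inr i)) \<inter> space M)"
      unfolding eq using I(2) by blast
    finally have "prob (\<Inter>k\<in>?J. ?U k -` A k \<inter> space M)
        = prob (\<Inter>i\<in>I. (\<lambda>\<omega>. (W i \<omega>, Y i \<omega>)) -` (A (Inl i) \<times> A (Inr i)) \<inter> space M)" by simp
    also have "\<dots> = (\<Prod>i\<in>I. prob ((\<lambda>\<omega>. (W i \<omega>, Y i \<omega>)) -` (A (Inl i) \<times> A (Inr i)) \<inter> space M))"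
      by (rule indep_varsD_finite[OF ind I(2,1)]) (use A' in auto)
    also have "\<dots> = (\<Prod>i\<in>I. prob (W i -` A (Inl i) \<inter> space M) * prob (Y i -` A (Inr i) \<inter> space M))"
      using prod A' by (intro prod.cong) (auto simp: eq)
    also have "\<dots> = (\<Prod>k\<in>?J. prob (?U k -` A k \<inter> space M))"
      using I by (subst prod.union_disjoint) (auto simp: prod.reindex prod.distrib)
    finally show ?thesis .
  qed
  ultimately have "indep_vars (\<lambda>_. borel) ?U ?J" by blast
  then have "indep_var (PiM (Inl ` I) (\<lambda>_. borel)) (\<lambda>\<omega>. restrict (\<lambda>k. ?U k \<omega>) (Inl ` I))
     (PiM (Inr ` I) (\<lambda>_. borel)) (\<lambda>\<omega>. restrict (\<lambda>k. ?U k \<omega>) (Inr ` I))"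
    by (rule indep_var_restrict) auto
  then have "indep_var (PiM I (\<lambda>_. borel)) ((\<lambda>f. \<lambda>i\<in>I. f (Inl i)) \<circ> (\<lambda>\<omega>. restrict (\<lambda>k. ?U k \<omega>) (Inl ` I)))
     (PiM I (\<lambda>_. borel)) ((\<lambda>f. \<lambda>i\<in>I. f (Inr i)) \<circ> (\<lambda>\<omega>. restrict (\<lambda>k. ?U k \<omega>) (Inr ` I)))"
    by (rule indep_var_compose) (auto intro!: measurable_restrict measurable_component_singleton)
  moreover have "(\<lambda>f. \<lambda>i\<in>I. f (Inl i)) \<circ> (\<lambda>\<omega>. restrict (\<lambda>k. ?U k \<omega>) (Inl ` I)) = (\<lambda>\<omega>. \<lambda>i\<in>I. W i \<omega>)"
    "(\<lambda>f. \<lambda>i\<in>I. f (Inr i)) \<circ> (\<lambda>\<omega>. restrict (\<lambda>k. ?U k \<omega>) (Inr ` I)) = (\<lambda>\<omega>. \<lambda>i\<in>I. Y i \<omega>)"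
    by (auto simp: fun_eq_iff restrict_def)
  ultimately show ?thesis by simp
qed

section \<open>The sigma-algebra of an observation and independence from it\<close>

lemma subalgebra_gen_sigma:
  assumes "\<And>i. i < n \<Longrightarrow> (\<lambda>\<omega>. U \<omega> i) \<in> borel_measurable M"
  shows "subalgebra M (gen_sigma M n U)"
proof -
  let ?G = "{(\<lambda>\<omega>. U \<omega> i) -` B \<inter> space M | i B. i < n \<and> B \<in> sets borel}"
  have "?G \<subseteq> sets M" using assms by (auto intro: measurable_sets)
  then show ?thesis
    unfolding subalgebra_def gen_sigma_def
    using sets.sigma_sets_subset[of ?G M] sets.space_closed[of M]
    by (subst sets_measure_of) (auto simp: space_measure_of_conv)
qed

lemma measurable_gen_sigma:
  assumes "i < n"
  shows "(\<lambda>\<omega>. U \<omega> i) \<in> borel_measurable (gen_sigma M n U)"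
proof -
  let ?G = "{(\<lambda>\<omega>. U \<omega> i) -` B \<inter> space M | i B. i < n \<and> B \<in> sets borel}"
  have "?G \<subseteq> Pow (space M)" by auto
  with assms show ?thesis
    unfolding gen_sigma_def
    by (intro measurableI) (simp, unfold sets_measure_of space_measure_of_conv, blast)
qed

text \<open>\<open>gen_sigma\<close> depends on its measure through the space alone, so
  \<open>M\<close> may be exchanged for \<open>F\<close> and minimality applied inside
  \<open>F\<close>.\<close>

lemma gen_sigma_sub:
  assumes "\<And>i. i < n \<Longrightarrow> (\<lambda>\<omega>. U \<omega> i) \<in> borel_measurable F" "space F = space M"
  shows "sets (gen_sigma M n U) \<subseteq> sets F"
proof -
  have "gen_sigma F n U = gen_sigma M n U" using assms(2) by (simp add: gen_sigma_def)
  then show ?thesis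
    using subalgebra_gen_sigma[of n U F, OF assms(1)] unfolding subalgebra_def by simp
qed


text \<open>Independence is stated through the sets of \<open>F\<close> rather than through a second
  random variable: it then passes to coarser sigma-algebras and fits \<open>real_cond_exp\<close>,
  which conditions on a sigma-algebra represented as a measure.\<close>

definition indep_subalgebra :: "'a measure \<Rightarrow> 'b measure \<Rightarrow> ('a \<Rightarrow> 'b) \<Rightarrow> 'a measure \<Rightarrow> bool" where
  "indep_subalgebra M N T F \<longleftrightarrow> T \<in> measurable M N \<and> subalgebra M F \<and>
    (\<forall>A\<in>sets N. \<forall>B\<in>sets F. measure M (T -` A \<inter> space M \<inter> B) = measure M (T -` A \<inter> space M) * measure M B)"

text \<open>The preimages under the whole vector generate a sigma-algebra for which every coordinate
  is measurable, so it contains \<open>gen_sigma M n U\<close>.\<close>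

lemma (in prob_space) indep_subalgebra_gen_sigma:
  assumes "indep_var (PiM {..<n} (\<lambda>_. borel)) T (PiM {..<n} (\<lambda>_. borel)) (\<lambda>\<omega>. \<lambda>i\<in>{..<n}. U \<omega> i)"
  shows "indep_subalgebra M (PiM {..<n} (\<lambda>_. borel)) T (gen_sigma M n U)"
proof -
  let ?V = "\<lambda>\<omega>. \<lambda>i\<in>{..<n}. U \<omega> i" and ?N = "PiM {..<n} (\<lambda>_. borel)"
  have T: "random_variable ?N T" and V: "random_variable ?N ?V"
    using indep_var_rv1[OF assms] indep_var_rv2[OF assms] by auto
  have U: "(\<lambda>\<omega>. U \<omega> i) \<in> borel_measurable M" if "i < n" for i
    using measurable_compose[OF V measurable_component_singleton, of i] that by simp
  let ?F = "sigma (space M) {?V -` A \<inter> space M | A. A \<in> sets ?N}"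
  have sp: "space ?F = space M" by (simp add: space_measure_of_conv)
  have st: "sets ?F = sigma_sets (space M) {?V -` A \<inter> space M | A. A \<in> sets ?N}"
    by (rule sets_measure_of) auto
  have VF: "?V \<in> measurable ?F ?N"
    using V by (intro measurableI) (auto simp: sp st dest: measurable_space)
  have "(\<lambda>\<omega>. U \<omega> i) \<in> borel_measurable ?F" if "i < n" for i
    using measurable_compose[OF VF measurable_component_singleton, of i] that by simp
  then have sub: "sets (gen_sigma M n U) \<subseteq> sets ?F"
    using sp by (rule gen_sigma_sub)
  have "indep_set (sigma_sets (space M) {T -` A \<inter> space M | A. A \<in> sets ?N}) (sets ?F)"
    using assms unfolding indep_var_eq st by simp
  then show ?thesis
    using sub T subalgebra_gen_sigma[of n U M, OF U]
    unfolding indep_sets2_eq indep_subalgebra_def by blast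
qed

lemma indep_subalgebra_mono:
  assumes "indep_subalgebra M N T F" "sets G \<subseteq> sets F" "space G = space M"
  shows "indep_subalgebra M N T G"
  using assms unfolding indep_subalgebra_def subalgebra_def by blast

lemma indep_subalgebra_compose:
  assumes "indep_subalgebra M N T F" "f \<in> measurable N K"
  shows "indep_subalgebra M K (\<lambda>\<omega>. f (T \<omega>)) F"
proof -
  have T: "T \<in> measurable M N" using assms(1) by (simp add: indep_subalgebra_def)
  have "(\<lambda>\<omega>. f (T \<omega>)) -` A \<inter> space M = T -` (f -` A \<inter> space N) \<inter> space M" for A
    using measurable_space[OF T] by auto
  then show ?thesis
    using assms(1) measurable_sets[OF assms(2)] measurable_compose[OF T assms(2)]
    unfolding indep_subalgebra_def by presburger
qed

text \<open>Events of \<open>S\<close> lie in \<open>F\<close>, so the product formula holds on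
  rectangles and determines the joint law. This is what allows \<open>T\<close> to be integrated out
  while \<open>S\<close> is held fixed.\<close>

lemma (in prob_space) indep_subalgebra_distr:
  assumes "indep_subalgebra M N T F" and S: "S \<in> measurable F K"
  shows "distr M N T \<Otimes>\<^sub>M distr M K S = distr M (N \<Otimes>\<^sub>M K) (\<lambda>\<omega>. (T \<omega>, S \<omega>))"
proof -
  have T[measurable]: "T \<in> measurable M N" and sa: "subalgebra M F"
    using assms(1) by (simp_all add: indep_subalgebra_def)
  have S'[measurable]: "S \<in> measurable M K" using measurable_from_subalg[OF sa S] .
  interpret T: prob_space "distr M N T" by (rule prob_space_distr) measurable
  interpret S: prob_space "distr M K S" by (rule prob_space_distr) measurable
  show ?thesis
  proof (rule pair_measure_eqI)
    show "sigma_finite_measure (distr M N T)" "sigma_finite_measure (distr M K S)" by unfold_locales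
    show "sets (distr M N T \<Otimes>\<^sub>M distr M K S) = sets (distr M (N \<Otimes>\<^sub>M K) (\<lambda>\<omega>. (T \<omega>, S \<omega>)))"
      by (simp cong: sets_pair_measure_cong)
    fix A B assume A: "A \<in> sets (distr M N T)" and B: "B \<in> sets (distr M K S)"
    have "S -` B \<inter> space M \<in> sets F"
      using measurable_sets[OF S, of B] B sa by (simp add: subalgebra_def)
    moreover have "(\<lambda>\<omega>. (T \<omega>, S \<omega>)) -` (A \<times> B) \<inter> space M = (T -` A \<inter> space M) \<inter> (S -` B \<inter> space M)"
      by auto
    ultimately have "prob ((\<lambda>\<omega>. (T \<omega>, S \<omega>)) -` (A \<times> B) \<inter> space M)
        = prob (T -` A \<inter> space M) * prob (S -` B \<inter> space M)"
      using assms(1) A unfolding indep_subalgebra_def by simp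
    then show "emeasure (distr M N T) A * emeasure (distr M K S) B = emeasure (distr M (N \<Otimes>\<^sub>M K) (\<lambda>\<omega>. (T \<omega>, S \<omega>))) (A \<times> B)"
      using A B by (simp add: emeasure_distr emeasure_eq_measure ennreal_mult)
  qed
qed

lemma (in prob_space) indep_subalgebra_imp_indep_var:
  assumes "indep_subalgebra M borel T F" and "S \<in> borel_measurable F"
  shows "indep_var borel T borel S"
proof -
  have "random_variable borel T" and sa: "subalgebra M F"
    using assms(1) unfolding indep_subalgebra_def by blast+
  moreover have "random_variable borel S" by (rule measurable_from_subalg[OF sa assms(2)])
  ultimately show ?thesis
    unfolding indep_var_distribution_eq using indep_subalgebra_distr[OF assms] by blast
qed

section \<open>Projections and Gaussian integrals\<close>

text \<open>The product is dominated by the sum of the squares.\<close>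

lemma integrable_mult_of_squares:
  fixes f g :: "'a \<Rightarrow> real"
  assumes [measurable]: "f \<in> borel_measurable M" "g \<in> borel_measurable M"
    and "integrable M (\<lambda>x. (f x)\<^sup>2)" "integrable M (\<lambda>x. (g x)\<^sup>2)"
  shows "integrable M (\<lambda>x. f x * g x)"
proof (rule Bochner_Integration.integrable_bound[OF Bochner_Integration.integrable_add[OF assms(3,4)]])
  show "AE x in M. norm (f x * g x) \<le> norm ((f x)\<^sup>2 + (g x)\<^sup>2)"
  proof (rule AE_I2)
    fix x
    have "2 * (\<bar>f x\<bar> * \<bar>g x\<bar>) \<le> (f x)\<^sup>2 + (g x)\<^sup>2"
      using sum_squares_bound[of "\<bar>f x\<bar>" "\<bar>g x\<bar>"] by simp
    moreover have "0 \<le> \<bar>f x\<bar> * \<bar>g x\<bar>" by simp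
    ultimately show "norm (f x * g x) \<le> norm ((f x)\<^sup>2 + (g x)\<^sup>2)"
      unfolding real_norm_def abs_mult by linarith
  qed
qed measurable

lemma integrable_power2_add:
  fixes f g :: "'a \<Rightarrow> real"
  assumes [measurable]: "f \<in> borel_measurable M" "g \<in> borel_measurable M"
    and "integrable M (\<lambda>x. (f x)\<^sup>2)" "integrable M (\<lambda>x. (g x)\<^sup>2)"
  shows "integrable M (\<lambda>x. (f x + g x)\<^sup>2)"
  using integrable_mult_of_squares[OF assms] assms(3,4)
  unfolding power2_sum by (simp add: mult.assoc)

lemma integrable_power2_diff:
  fixes f g :: "'a \<Rightarrow> real"
  assumes "f \<in> borel_measurable M" "g \<in> borel_measurable M"
    and "integrable M (\<lambda>x. (f x)\<^sup>2)" "integrable M (\<lambda>x. (g x)\<^sup>2)"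
  shows "integrable M (\<lambda>x. (f x - g x)\<^sup>2)"
  using integrable_power2_add[of f M "\<lambda>x. - g x"] assms by simp

text \<open>With \<open>h = g - E V\<close>, both \<open>E (h V) = E h\<^sup>2\<close> and, by independence, \<open>E (h T) = 0\<close>; so the last claim
  follows from \<open>E (V - T - h)\<^sup>2 \<ge> 0\<close>.\<close>

lemma (in prob_space)
  fixes V :: "'a \<Rightarrow> real"
  assumes sa: "subalgebra M F" and [measurable]: "V \<in> borel_measurable M" and V2: "integrable M (\<lambda>\<omega>. (V \<omega>)\<^sup>2)"
  defines "g \<equiv> real_cond_exp M F V"
  shows integrable_cond_exp_power2: "integrable M (\<lambda>\<omega>. (g \<omega>)\<^sup>2)"
    and cond_exp_pythagoras: "expectation (\<lambda>\<omega>. (V \<omega> - expectation V)\<^sup>2)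
        = expectation (\<lambda>\<omega>. (V \<omega> - g \<omega>)\<^sup>2) + expectation (\<lambda>\<omega>. (g \<omega> - expectation V)\<^sup>2)"
    and cond_exp_variance_le: "indep_subalgebra M borel T F \<Longrightarrow> integrable M (\<lambda>\<omega>. (T \<omega>)\<^sup>2) \<Longrightarrow>
      expectation (\<lambda>\<omega>. (g \<omega> - expectation V)\<^sup>2) \<le> expectation (\<lambda>\<omega>. (V \<omega> - T \<omega>)\<^sup>2)"
proof -
  interpret finite_measure_subalgebra M F
    using sa by unfold_locales
  have V: "integrable M V" by (rule square_integrable_imp_integrable) (use V2 in auto)
  \<comment> \<open>Conditional Jensen for the square: conditioning preserves square
    integrability.\<close>
  have "convex_on UNIV (\<lambda>x::real. x\<^sup>2)" by (rule convex_power2)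
  then show g2: "integrable M (\<lambda>\<omega>. (g \<omega>)\<^sup>2)"
    unfolding g_def using integrable_convex_cond_exp[of V UNIV _ _ "\<lambda>x. x\<^sup>2"] V V2 by simp
  have gF[measurable]: "g \<in> borel_measurable F" unfolding g_def by simp
  have gM[measurable]: "g \<in> borel_measurable M" unfolding g_def by simp
  define m where "m = expectation V"
  define h where "h = (\<lambda>\<omega>. g \<omega> - m)"
  have hF[measurable]: "h \<in> borel_measurable F" and hM[measurable]: "h \<in> borel_measurable M"
    unfolding h_def by measurable
  have h2: "integrable M (\<lambda>\<omega>. (h \<omega>)\<^sup>2)" unfolding h_def
    by (rule integrable_power2_diff) (use g2 in auto)
  have hI: "integrable M h" by (rule square_integrable_imp_integrable) (use h2 in auto)
  have gI: "integrable M g" by (rule square_integrable_imp_integrable) (use g2 in auto)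
  have Eg: "expectation g = m" unfolding g_def m_def using real_cond_exp_int(2)[OF V] .
  have Eh: "expectation h = 0" unfolding h_def using gI Eg by (simp add: prob_space)
  have hV: "integrable M (\<lambda>\<omega>. h \<omega> * V \<omega>)" and hg: "integrable M (\<lambda>\<omega>. h \<omega> * g \<omega>)"
    by (rule integrable_mult_of_squares; use h2 V2 g2 in auto)+
  have EhV: "expectation (\<lambda>\<omega>. h \<omega> * V \<omega>) = expectation (\<lambda>\<omega>. h \<omega> * g \<omega>)"
    unfolding g_def by (rule real_cond_exp_intg(2)[symmetric, OF hV]) auto
  \<comment> \<open>The two sides differ by \<open>m * expectation h\<close>, and \<open>h\<close>
    is centred.\<close>
  have Ehg: "expectation (\<lambda>\<omega>. h \<omega> * g \<omega>) = expectation (\<lambda>\<omega>. (h \<omega>)\<^sup>2)"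
  proof -
    have "expectation (\<lambda>\<omega>. (h \<omega>)\<^sup>2) = expectation (\<lambda>\<omega>. h \<omega> * g \<omega> - m * h \<omega>)"
      by (intro Bochner_Integration.integral_cong) (auto simp: h_def power2_eq_square algebra_simps)
    also have "\<dots> = expectation (\<lambda>\<omega>. h \<omega> * g \<omega>) - m * expectation h"
      using hg hI by simp
    finally show ?thesis using Eh by simp
  qed
  have Vg2: "integrable M (\<lambda>\<omega>. (V \<omega> - g \<omega>)\<^sup>2)"
    by (rule integrable_power2_diff) (use V2 g2 in auto)
  have "expectation (\<lambda>\<omega>. (V \<omega> - m)\<^sup>2)
      = expectation (\<lambda>\<omega>. (V \<omega> - g \<omega>)\<^sup>2 + 2 * (h \<omega> * V \<omega>) - 2 * (h \<omega> * g \<omega>) + (h \<omega>)\<^sup>2)"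
    by (intro Bochner_Integration.integral_cong) (auto simp: h_def power2_eq_square algebra_simps)
  also have "\<dots> = expectation (\<lambda>\<omega>. (V \<omega> - g \<omega>)\<^sup>2) + 2 * expectation (\<lambda>\<omega>. h \<omega> * V \<omega>)
      - 2 * expectation (\<lambda>\<omega>. h \<omega> * g \<omega>) + expectation (\<lambda>\<omega>. (h \<omega>)\<^sup>2)"
    using Vg2 hV hg h2 by simp
  finally show "expectation (\<lambda>\<omega>. (V \<omega> - expectation V)\<^sup>2)
        = expectation (\<lambda>\<omega>. (V \<omega> - g \<omega>)\<^sup>2) + expectation (\<lambda>\<omega>. (g \<omega> - expectation V)\<^sup>2)"
    using EhV unfolding m_def h_def by simp
  assume ind: "indep_subalgebra M borel T F" and T2: "integrable M (\<lambda>\<omega>. (T \<omega>)\<^sup>2)"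
  have [measurable]: "T \<in> borel_measurable M" using ind by (simp add: indep_subalgebra_def)
  have T: "integrable M T" by (rule square_integrable_imp_integrable) (use T2 in auto)
  have "indep_var borel T borel h" by (rule indep_subalgebra_imp_indep_var[OF ind hF])
  note Th = indep_var_integrable[OF this T hI] indep_var_lebesgue_integral[OF this T hI]
  have VT2: "integrable M (\<lambda>\<omega>. (V \<omega> - T \<omega>)\<^sup>2)"
    by (rule integrable_power2_diff) (use V2 T2 in auto)
  have "0 \<le> expectation (\<lambda>\<omega>. ((V \<omega> - T \<omega>) - h \<omega>)\<^sup>2)" by simp
  also have "\<dots> = expectation (\<lambda>\<omega>. (V \<omega> - T \<omega>)\<^sup>2 - 2 * (h \<omega> * V \<omega>) + 2 * (T \<omega> * h \<omega>) + (h \<omega>)\<^sup>2)"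
    by (intro Bochner_Integration.integral_cong) (auto simp: power2_eq_square algebra_simps)
  also have "\<dots> = expectation (\<lambda>\<omega>. (V \<omega> - T \<omega>)\<^sup>2) - 2 * expectation (\<lambda>\<omega>. h \<omega> * V \<omega>)
      + 2 * expectation (\<lambda>\<omega>. T \<omega> * h \<omega>) + expectation (\<lambda>\<omega>. (h \<omega>)\<^sup>2)"
    using VT2 hV Th(1) h2 by simp
  finally show "expectation (\<lambda>\<omega>. (g \<omega> - expectation V)\<^sup>2) \<le> expectation (\<lambda>\<omega>. (V \<omega> - T \<omega>)\<^sup>2)"
    using EhV Ehg Eh Th(2) unfolding h_def m_def by simp
qed

text \<open>The integrand is one of the \<open>n!\<close> nonnegative terms of a sum over
  permutations, and each term is a product of shifted densities of total mass one. The shift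
  \<open>a\<close> and the centre \<open>g\<close> are held fixed here.\<close>

lemma nn_integral_sortvec_normal_le:
  fixes a g :: "nat \<Rightarrow> real"
  assumes t: "t > 0"
  shows "(\<integral>\<^sup>+w. (\<Prod>i<n. ennreal (normal_density (g i) t (sortvec n (\<lambda>j. w j + a j) i))) \<partial>PiM {..<n} (\<lambda>_. lborel)) \<le> fact n"
proof -
  interpret product_sigma_finite "\<lambda>_. lborel :: real measure" by unfold_locales
  let ?P = "{p. p permutes {..<n}}"
  let ?L = "PiM {..<n} (\<lambda>_. lborel :: real measure)"
  define e where "e = (\<lambda>i x. ennreal (normal_density (g i) t x))"
  have [measurable]: "e i \<in> borel_measurable borel" for i unfolding e_def by measurable
  have one: "(\<integral>\<^sup>+x. e i (x + c) \<partial>lborel) = 1" for i c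
  proof -
    have "(\<integral>\<^sup>+x. e i (x + c) \<partial>lborel) = (\<integral>\<^sup>+x. e i x \<partial>lborel)"
      using nn_integral_real_affine[of "e i" 1 c] by (simp add: add.commute)
    also have "\<dots> = 1" unfolding e_def using t by (simp add: nn_integral_eq_integral)
    finally show ?thesis .
  qed
  have perm: "(\<integral>\<^sup>+w. (\<Prod>i<n. e i (w (p i) + a (p i))) \<partial>?L) = 1" if p: "p permutes {..<n}" for p
  proof -
    \<comment> \<open>Reindexing by \<open>inv p\<close> attaches one density to each coordinate, so
      that the integral factorizes.\<close>
    have "(\<Prod>i<n. e i (w (p i) + a (p i))) = (\<Prod>j<n. e (inv p j) (w j + a j))" for w
      using prod.permute[OF p, of "\<lambda>j. e (inv p j) (w j + a j)"] permutes_inverses(2)[OF p] by (simp add: comp_def)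
    then have "(\<integral>\<^sup>+w. (\<Prod>i<n. e i (w (p i) + a (p i))) \<partial>?L) = (\<integral>\<^sup>+w. (\<Prod>j<n. e (inv p j) (w j + a j)) \<partial>?L)"
      by (intro nn_integral_cong)
    also have "\<dots> = (\<Prod>j<n. \<integral>\<^sup>+x. e (inv p j) (x + a j) \<partial>lborel)"
      by (rule product_nn_integral_prod) auto
    also have "\<dots> = 1" by (simp add: one)
    finally show ?thesis .
  qed
  have "(\<integral>\<^sup>+w. (\<Prod>i<n. e i (sortvec n (\<lambda>j. w j + a j) i)) \<partial>?L)
      \<le> (\<integral>\<^sup>+w. (\<Sum>p\<in>?P. \<Prod>i<n. e i (w (p i) + a (p i))) \<partial>?L)"
  proof (rule nn_integral_mono)
    fix w
    obtain p where p: "p permutes {..<n}" "\<And>i. i < n \<Longrightarrow> sortvec n (\<lambda>j. w j + a j) i = w (p i) + a (p i)"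
      by (rule sortvec_eq_permute[of n "\<lambda>j. w j + a j"]) blast
    then have "(\<Prod>i<n. e i (sortvec n (\<lambda>j. w j + a j) i)) = (\<Prod>i<n. e i (w (p i) + a (p i)))" by simp
    also have "\<dots> \<le> (\<Sum>p\<in>?P. \<Prod>i<n. e i (w (p i) + a (p i)))"
      using p(1) by (intro member_le_sum) (auto simp: finite_permutations)
    finally show "(\<Prod>i<n. e i (sortvec n (\<lambda>j. w j + a j) i)) \<le> (\<Sum>p\<in>?P. \<Prod>i<n. e i (w (p i) + a (p i)))" .
  qed
  also have "\<dots> = (\<Sum>p\<in>?P. \<integral>\<^sup>+w. (\<Prod>i<n. e i (w (p i) + a (p i))) \<partial>?L)"
  proof (rule nn_integral_sum)
    fix p assume "p \<in> ?P"
    then have "p i < n" if "i < n" for i using that permutes_in_image[of p "{..<n}" i] by auto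
    then have [measurable]: "(\<lambda>w. w (p i)) \<in> borel_measurable ?L" if "i \<in> {..<n}" for i
      using that measurable_component_singleton[of "p i" "{..<n}" "\<lambda>_. lborel :: real measure"] by simp
    show "(\<lambda>w. \<Prod>i<n. e i (w (p i) + a (p i))) \<in> borel_measurable ?L"
      by measurable
  qed
  also have "\<dots> = fact n"
    using perm by (simp add: card_permutations[OF refl] of_nat_fact)
  finally show ?thesis unfolding e_def .
qed

section \<open>The lower bound on the sorted error\<close>

text \<open>Both measures agree on rectangles, where the integral factorizes; uniqueness of the
  product measure does the rest.\<close>

lemma PiM_density_lborel:
  fixes f :: "'i \<Rightarrow> real \<Rightarrow> ennreal"
  assumes I: "finite I" and f[measurable]: "\<And>i. i \<in> I \<Longrightarrow> f i \<in> borel_measurable borel"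
    and ps: "\<And>i. i \<in> I \<Longrightarrow> prob_space (density lborel (f i))"
  shows "PiM I (\<lambda>i. density lborel (f i)) = density (PiM I (\<lambda>_. lborel)) (\<lambda>x. \<Prod>i\<in>I. f i (x i))"
proof -
  \<comment> \<open>The product-measure locale wants sigma-finiteness at every index, while
    \<open>f\<close> is controlled on \<open>I\<close> only; \<open>lborel\<close> fills the
    remaining indices.\<close>
  define N where "N = (\<lambda>i. if i \<in> I then density lborel (f i) else lborel)"
  have "sigma_finite_measure (N i)" for i
    using ps prob_space_imp_sigma_finite by (auto simp: N_def lborel.sigma_finite_measure_axioms)
  then interpret N: product_sigma_finite N by (simp add: product_sigma_finite_def)
  interpret L: product_sigma_finite "\<lambda>_. lborel :: real measure" by unfold_locales
  have [measurable]: "(\<lambda>x. \<Prod>i\<in>I. f i (x i)) \<in> borel_measurable (PiM I (\<lambda>_. lborel))"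
    by (intro borel_measurable_prod_ennreal measurable_compose[OF measurable_component_singleton]) (use f in auto)
  have "density (PiM I (\<lambda>_. lborel)) (\<lambda>x. \<Prod>i\<in>I. f i (x i)) = PiM I N"
  proof (rule N.PiM_eqI[OF I])
    show "sets (density (PiM I (\<lambda>_. lborel)) (\<lambda>x. \<Prod>i\<in>I. f i (x i))) = sets (PiM I N)"
      by (simp add: N_def cong: sets_PiM_cong)
    fix A assume "\<And>i. i \<in> I \<Longrightarrow> A i \<in> sets (N i)"
    then have A[measurable]: "A i \<in> sets borel" if "i \<in> I" for i using that by (force simp: N_def)
    have "emeasure (density (PiM I (\<lambda>_. lborel)) (\<lambda>x. \<Prod>i\<in>I. f i (x i))) (PiE I A)
        = (\<integral>\<^sup>+x. (\<Prod>i\<in>I. f i (x i)) * indicator (PiE I A) x \<partial>PiM I (\<lambda>_. lborel))"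
      using A I by (intro emeasure_density) (auto intro!: sets_PiM_I_finite)
    also have "\<dots> = (\<integral>\<^sup>+x. (\<Prod>i\<in>I. f i (x i) * indicator (A i) (x i)) \<partial>PiM I (\<lambda>_. lborel))"
    proof (rule nn_integral_cong)
      fix x assume "x \<in> space (PiM I (\<lambda>_. lborel :: real measure))"
      then have "indicator (PiE I A) x = (\<Prod>i\<in>I. indicator (A i) (x i) :: ennreal)"
        using I by (auto simp: space_PiM PiE_def indicator_def prod.If_cases Pi_iff intro: prod_zero)
      then show "(\<Prod>i\<in>I. f i (x i)) * indicator (PiE I A) x = (\<Prod>i\<in>I. f i (x i) * indicator (A i) (x i))"
        by (simp add: prod.distrib)
    qed
    also have "\<dots> = (\<Prod>i\<in>I. \<integral>\<^sup>+x. f i x * indicator (A i) x \<partial>lborel)"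
      using I f A by (intro L.product_nn_integral_prod) auto
    also have "\<dots> = (\<Prod>i\<in>I. emeasure (N i) (A i))"
      by (intro prod.cong) (auto simp: N_def emeasure_density)
    finally show "emeasure (density (PiM I (\<lambda>_. lborel)) (\<lambda>x. \<Prod>i\<in>I. f i (x i))) (PiE I A)
        = (\<Prod>i\<in>I. emeasure (N i) (A i))" .
  qed
  also have "PiM I N = PiM I (\<lambda>i. density lborel (f i))"
    by (intro PiM_cong) (auto simp: N_def)
  finally show ?thesis ..
qed

lemma PiM_normal_density:
  fixes n :: nat
  assumes "s > 0"
  shows "PiM {..<n} (\<lambda>_. density lborel (\<lambda>x. ennreal (normal_density 0 s x)))
    = density (PiM {..<n} (\<lambda>_. lborel)) (\<lambda>w. \<Prod>i<n. ennreal (normal_density 0 s (w i)))"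
  using prob_space_normal_density[OF assms] by (intro PiM_density_lborel) auto

lemma (in prob_space) distr_indep_normal:
  fixes n :: nat
  assumes ind: "indep_vars (\<lambda>_. borel) W {..<n}" and n: "n \<ge> 1"
    and W: "\<And>i. i < n \<Longrightarrow> distributed M lborel (W i) (\<lambda>x. ennreal (normal_density 0 s x))"
  shows "distr M (PiM {..<n} (\<lambda>_. borel)) (\<lambda>\<omega>. \<lambda>i\<in>{..<n}. W i \<omega>)
      = PiM {..<n} (\<lambda>_. density lborel (\<lambda>x. ennreal (normal_density 0 s x)))" (is "?D = ?P")
proof -
  have ne: "{..<n} \<noteq> {}" using n by (auto simp: lessThan_empty_iff)
  have rv: "random_variable borel (W i)" if "i \<in> {..<n}" for i
    using ind that by (auto simp: indep_vars_def)
  have "?D = PiM {..<n} (\<lambda>i. distr M borel (W i))"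
    using ind indep_vars_iff_distr_eq_PiM'[OF ne, of W "\<lambda>_. borel"] rv by blast
  also have "\<dots> = ?P"
  proof (rule PiM_cong)
    fix i assume "i \<in> {..<n}"
    have "distr M borel (W i) = distr M lborel (W i)" by (rule distr_cong) auto
    also have "\<dots> = density lborel (\<lambda>x. ennreal (normal_density 0 s x))"
      using W \<open>i \<in> {..<n}\<close> by (intro distributed_distr_eq_density) auto
    finally show "distr M borel (W i) = density lborel (\<lambda>x. ennreal (normal_density 0 s x))" .
  qed simp
  finally show ?thesis .
qed

text \<open>Joint measurability in point, shift and centre prepares for Fubini, since shift and
  centre become random.\<close>

lemma measurable_sortvec_gaussian:
  "(\<lambda>(w, a, g). \<Prod>i<n. ennreal (normal_density (g i) t (sortvec n (\<lambda>j. w j + a j) i)))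
    \<in> borel_measurable (PiM {..<n} (\<lambda>_. borel) \<Otimes>\<^sub>M PiM {..<n} (\<lambda>_. borel) \<Otimes>\<^sub>M PiM {..<n} (\<lambda>_. borel))"
  unfolding normal_density_def by measurable

text \<open>The scale \<open>t\<close> in the proof is chosen so that the likelihood ratio of the Gaussian guess
  \<open>N(G, t\<^sup>2 I)\<close> for the sorted vector and the true conditional law of the unsorted one is exactly
  \<open>n! exp L\<close>; then \<open>E (exp L) \<le> 1\<close> and \<open>1 + L \<le> exp L\<close> give \<open>E L \<le> 0\<close>.\<close>

lemma (in prob_space) expectation_sortvec_error_ge:
  fixes W A G :: "nat \<Rightarrow> 'a \<Rightarrow> real"
  assumes n: "n \<ge> 1" and s: "s > 0"
    and ind: "indep_subalgebra M (PiM {..<n} (\<lambda>_. borel)) (\<lambda>\<omega>. \<lambda>i\<in>{..<n}. W i \<omega>) F"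
    and law: "distr M (PiM {..<n} (\<lambda>_. borel)) (\<lambda>\<omega>. \<lambda>i\<in>{..<n}. W i \<omega>)
      = density (PiM {..<n} (\<lambda>_. lborel)) (\<lambda>w. \<Prod>i<n. ennreal (normal_density 0 s (w i)))"
    and A: "\<And>i. i < n \<Longrightarrow> A i \<in> borel_measurable F"
    and G: "\<And>i. i < n \<Longrightarrow> G i \<in> borel_measurable F"
    and W2: "\<And>i. i < n \<Longrightarrow> integrable M (\<lambda>\<omega>. (W i \<omega>)\<^sup>2)" "\<And>i. i < n \<Longrightarrow> expectation (\<lambda>\<omega>. (W i \<omega>)\<^sup>2) = s\<^sup>2"
    and err: "\<And>i. i < n \<Longrightarrow> integrable M (\<lambda>\<omega>. (sortvec n (\<lambda>j. W j \<omega> + A j \<omega>) i - G i \<omega>)\<^sup>2)"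
  shows "real n * s\<^sup>2 / fact n powr (2 / real n)
    \<le> expectation (\<lambda>\<omega>. \<Sum>i<n. (sortvec n (\<lambda>j. W j \<omega> + A j \<omega>) i - G i \<omega>)\<^sup>2)"
proof -
  let ?N = "PiM {..<n} (\<lambda>_. borel :: real measure)"
  let ?L = "PiM {..<n} (\<lambda>_. lborel :: real measure)"
  define V where "V = (\<lambda>i \<omega>. sortvec n (\<lambda>j. W j \<omega> + A j \<omega>) i)"
  \<comment> \<open>With \<open>q\<close> the n-th root of \<open>n!\<close>, shrinking the scale by
    \<open>q\<close> multiplies the n-dimensional normalizing constant by exactly
    \<open>n!\<close>.\<close>
  define q where "q = (fact n :: real) powr (1 / real n)"
  define t where "t = s / q"
  have q: "q > 0" unfolding q_def by simp
  have t: "t > 0" unfolding t_def using s q by simp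
  have qn: "q ^ n = fact n"
    unfolding q_def using n by (simp add: powr_powr flip: powr_realpow)
  have t2: "t\<^sup>2 = s\<^sup>2 / fact n powr (2 / real n)"
    unfolding t_def q_def by (simp add: power_divide power2_eq_square flip: powr_add)
  \<comment> \<open>\<open>L\<close> is the difference of the two Gaussian exponents, that is, the
    log-likelihood ratio minus \<open>ln (fact n)\<close>.\<close>
  define L where "L = (\<lambda>\<omega>. (\<Sum>i<n. (W i \<omega>)\<^sup>2) / (2 * s\<^sup>2) - (\<Sum>i<n. (V i \<omega> - G i \<omega>)\<^sup>2) / (2 * t\<^sup>2))"
  \<comment> \<open>The ratio divided by \<open>n!\<close>, as a function of point, shift and
    centre, so that it can be integrated against a law.\<close>
  define \<Phi> where "\<Phi> = (\<lambda>(w, a, g). (\<Prod>i<n. ennreal (normal_density (g i) t (sortvec n (\<lambda>j. w j + a j) i))) /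
      (fact n * (\<Prod>i<n. ennreal (normal_density 0 s (w i)))))"
  define T where "T = (\<lambda>\<omega>. \<lambda>i\<in>{..<n}. W i \<omega>)"
  define S where "S = (\<lambda>\<omega>. (\<lambda>i\<in>{..<n}. A i \<omega>, \<lambda>i\<in>{..<n}. G i \<omega>))"
  have sa: "subalgebra M F" and T[measurable]: "T \<in> measurable M ?N"
    using ind unfolding indep_subalgebra_def T_def by auto
  have SF: "S \<in> measurable F (?N \<Otimes>\<^sub>M ?N)"
    unfolding S_def using A G by (intro measurable_Pair measurable_restrict) auto
  have [measurable]: "S \<in> measurable M (?N \<Otimes>\<^sub>M ?N)" by (rule measurable_from_subalg[OF sa SF])
  have \<Phi>[measurable]: "\<Phi> \<in> borel_measurable (?N \<Otimes>\<^sub>M ?N \<Otimes>\<^sub>M ?N)"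
    unfolding \<Phi>_def using measurable_sortvec_gaussian[where n=n and t=t, measurable]
    unfolding case_prod_beta by measurable
  have exp_L: "ennreal (exp (L \<omega>)) = \<Phi> (T \<omega>, S \<omega>)" for \<omega>
  proof -
    \<comment> \<open>\<open>T\<close> and \<open>S\<close> carry restricted functions, whose
      default value \<open>undefined\<close> beyond \<open>n\<close> must not affect the sorted
      vector.\<close>
    have sv: "sortvec n (\<lambda>j. (if j < n then W j \<omega> else undefined) + (if j < n then A j \<omega> else undefined)) = sortvec n (\<lambda>j. W j \<omega> + A j \<omega>)"
      by (rule sortvec_cong) simp
    have k: "(1 / sqrt (2 * pi * t\<^sup>2)) ^ n = fact n * (1 / sqrt (2 * pi * s\<^sup>2)) ^ n"
      unfolding t_def using s q qn by (simp add: power_divide real_sqrt_mult real_sqrt_divide power_mult_distrib)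
    define \<kappa> where "\<kappa> = (1 / sqrt (2 * pi * s\<^sup>2)) ^ n"
    define a where "a = (\<Sum>i<n. (W i \<omega>)\<^sup>2) / (2 * s\<^sup>2)"
    define b where "b = (\<Sum>i<n. (V i \<omega> - G i \<omega>)\<^sup>2) / (2 * t\<^sup>2)"
    have \<kappa>: "\<kappa> > 0" unfolding \<kappa>_def using s by simp
    have "(\<Prod>i<n. normal_density (G i \<omega>) t (V i \<omega>)) = (1 / sqrt (2 * pi * t\<^sup>2)) ^ n * exp (- b)"
      unfolding normal_density_def prod.distrib b_def
      by (simp add: exp_sum[symmetric] sum_negf sum_divide_distrib)
    then have p1: "(\<Prod>i<n. normal_density (G i \<omega>) t (V i \<omega>)) = fact n * \<kappa> * exp (- b)"
      unfolding k \<kappa>_def .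
    have p2: "(\<Prod>i<n. normal_density 0 s (W i \<omega>)) = \<kappa> * exp (- a)"
      unfolding normal_density_def prod.distrib a_def \<kappa>_def
      by (simp add: exp_sum[symmetric] sum_negf sum_divide_distrib)
    have L: "L \<omega> = a - b" by (simp add: L_def a_def b_def)
    have "exp (L \<omega>) = (\<Prod>i<n. normal_density (G i \<omega>) t (V i \<omega>)) / (fact n * (\<Prod>i<n. normal_density 0 s (W i \<omega>)))"
      unfolding p1 p2 L using \<kappa> by (simp add: exp_diff exp_minus field_simps)
    moreover have "(\<Prod>i<n. normal_density 0 s (W i \<omega>)) > 0"
      using normal_density_pos[OF s] by (intro prod_pos) auto
    ultimately show ?thesis
      unfolding \<Phi>_def T_def S_def
      by (simp add: sv prod_ennreal V_def divide_ennreal prod_nonneg ennreal_mult[symmetric] flip: ennreal_fact)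
  qed
  have "(\<integral>\<^sup>+\<omega>. ennreal (exp (L \<omega>)) \<partial>M) = (\<integral>\<^sup>+x. \<Phi> x \<partial>distr M (?N \<Otimes>\<^sub>M ?N \<Otimes>\<^sub>M ?N) (\<lambda>\<omega>. (T \<omega>, S \<omega>)))"
    unfolding exp_L by (subst nn_integral_distr) measurable
  \<comment> \<open>Independence of \<open>W\<close> from \<open>F\<close> replaces the joint law by
    a product law; Fubini then integrates over \<open>W\<close> first.\<close>
  also have "\<dots> = (\<integral>\<^sup>+x. \<Phi> x \<partial>(distr M ?N T \<Otimes>\<^sub>M distr M (?N \<Otimes>\<^sub>M ?N) S))"
    using indep_subalgebra_distr[OF ind[folded T_def] SF] by simp
  also have "\<dots> = (\<integral>\<^sup>+y. \<integral>\<^sup>+w. \<Phi> (w, y) \<partial>distr M ?N T \<partial>distr M (?N \<Otimes>\<^sub>M ?N) S)"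
  proof -
    interpret DT: prob_space "distr M ?N T" by (rule prob_space_distr) measurable
    interpret DS: prob_space "distr M (?N \<Otimes>\<^sub>M ?N) S" by (rule prob_space_distr) measurable
    interpret pair_sigma_finite "distr M ?N T" "distr M (?N \<Otimes>\<^sub>M ?N) S" by unfold_locales
    show ?thesis by (rule nn_integral_snd[symmetric]) measurable
  qed
  also have "\<dots> \<le> (\<integral>\<^sup>+y. 1 \<partial>distr M (?N \<Otimes>\<^sub>M ?N) S)"
  proof (rule nn_integral_mono)
    fix y assume y: "y \<in> space (distr M (?N \<Otimes>\<^sub>M ?N) S)"
    obtain a g where ag: "y = (a, g)" by (cases y)
    have y': "y \<in> space (?N \<Otimes>\<^sub>M ?N)" using y by simp
    have [measurable]: "(\<lambda>w. \<Phi> (w, y)) \<in> borel_measurable ?N"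
      using y' by measurable
    then have [measurable]: "(\<lambda>w. \<Phi> (w, y)) \<in> borel_measurable ?L"
      by (simp cong: measurable_cong_sets sets_PiM_cong)
    have "(\<integral>\<^sup>+w. \<Phi> (w, y) \<partial>distr M ?N T) = (\<integral>\<^sup>+w. (\<Prod>i<n. ennreal (normal_density 0 s (w i))) * \<Phi> (w, y) \<partial>?L)"
      unfolding law[folded T_def] by (rule nn_integral_density) auto
    \<comment> \<open>The density of \<open>W\<close> cancels the denominator of
      \<open>\<Phi>\<close>, leaving \<open>1 / fact n\<close> times an integral that is at most
      \<open>fact n\<close>.\<close>
    also have "\<dots> = (\<integral>\<^sup>+w. (1 / fact n) * (\<Prod>i<n. ennreal (normal_density (g i) t (sortvec n (\<lambda>j. w j + a j) i))) \<partial>?L)"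
    proof (rule nn_integral_cong)
      fix w
      have pos: "(\<Prod>i<n. normal_density 0 s (w i)) > 0"
        using normal_density_pos[OF s] by (intro prod_pos) auto
      then show "(\<Prod>i<n. ennreal (normal_density 0 s (w i))) * \<Phi> (w, y)
        = (1 / fact n) * (\<Prod>i<n. ennreal (normal_density (g i) t (sortvec n (\<lambda>j. w j + a j) i)))"
        unfolding \<Phi>_def ag using normal_density_pos[OF s, THEN less_imp_neq, symmetric]
        by (simp add: prod_ennreal prod_nonneg divide_ennreal ennreal_mult[symmetric] flip: ennreal_fact ennreal_1)
    qed
    also have "\<dots> = (1 / fact n) * (\<integral>\<^sup>+w. (\<Prod>i<n. ennreal (normal_density (g i) t (sortvec n (\<lambda>j. w j + a j) i))) \<partial>?L)"
      unfolding normal_density_def by (rule nn_integral_cmult) measurable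
    also have "\<dots> \<le> (1 / fact n) * fact n"
      by (intro mult_left_mono nn_integral_sortvec_normal_le[OF t]) simp
    also have "\<dots> = 1"
      by (simp add: divide_ennreal ennreal_mult[symmetric] flip: ennreal_fact ennreal_1)
    finally show "(\<integral>\<^sup>+w. \<Phi> (w, y) \<partial>distr M ?N T) \<le> 1" .
  qed
  also have "\<dots> = 1"
    using prob_space.emeasure_space_1[OF prob_space_distr[of S "?N \<Otimes>\<^sub>M ?N"]] by simp
  finally have le1: "(\<integral>\<^sup>+\<omega>. ennreal (exp (L \<omega>)) \<partial>M) \<le> 1" .
  have IW: "integrable M (\<lambda>\<omega>. \<Sum>i<n. (W i \<omega>)\<^sup>2)"
    by (rule Bochner_Integration.integrable_sum) (use W2(1) in simp)
  have IV: "integrable M (\<lambda>\<omega>. \<Sum>i<n. (V i \<omega> - G i \<omega>)\<^sup>2)"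
    unfolding V_def by (rule Bochner_Integration.integrable_sum) (use err in simp)
  have LI: "integrable M L"
    unfolding L_def by (intro Bochner_Integration.integrable_diff integrable_divide IW IV)
  have "expectation (\<lambda>\<omega>. \<Sum>i<n. (W i \<omega>)\<^sup>2) = real n * s\<^sup>2"
    using W2 by (subst Bochner_Integration.integral_sum) auto
  then have EL: "expectation L = real n / 2 - expectation (\<lambda>\<omega>. \<Sum>i<n. (V i \<omega> - G i \<omega>)\<^sup>2) / (2 * t\<^sup>2)"
    unfolding L_def using s by (subst Bochner_Integration.integral_diff[OF integrable_divide[OF IW] integrable_divide[OF IV]]) simp
  have [measurable]: "L \<in> borel_measurable M" using LI by simp
  \<comment> \<open>The bound on the nonnegative integral also supplies integrability, so that it
    transfers to the Bochner expectation.\<close>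
  have eI: "integrable M (\<lambda>\<omega>. exp (L \<omega>))"
    using le1 by (intro integrableI_bounded) (auto intro: le_less_trans)
  have "ennreal (expectation (\<lambda>\<omega>. exp (L \<omega>))) \<le> 1"
    using le1 by (simp add: nn_integral_eq_integral[OF eI])
  then have "expectation (\<lambda>\<omega>. exp (L \<omega>)) \<le> 1" by simp
  moreover have "expectation (\<lambda>\<omega>. 1 + L \<omega>) \<le> expectation (\<lambda>\<omega>. exp (L \<omega>))"
    using LI eI by (intro integral_mono) (auto simp: exp_ge_add_one_self)
  moreover have "expectation (\<lambda>\<omega>. 1 + L \<omega>) = 1 + expectation L"
    using LI by (simp add: prob_space)
  ultimately have "real n / 2 \<le> expectation (\<lambda>\<omega>. \<Sum>i<n. (V i \<omega> - G i \<omega>)\<^sup>2) / (2 * t\<^sup>2)"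
    using EL by simp
  then have "real n * t\<^sup>2 \<le> expectation (\<lambda>\<omega>. \<Sum>i<n. (V i \<omega> - G i \<omega>)\<^sup>2)"
    using t by (simp add: field_simps)
  then show ?thesis unfolding t2 V_def by simp
qed

section \<open>The entropy of a sorted Gaussian vector\<close>

lemma sortvec_mono: "i \<le> j \<Longrightarrow> j < n \<Longrightarrow> sortvec n x i \<le> sortvec n x j"
  by (simp add: sortvec_def sorted_nth_mono)

lemma sortvec_in_space: "sortvec n x \<in> space (PiM {..<n} (\<lambda>_. borel))"
  by (simp add: sortvec_def space_PiM)

text \<open>With distinct entries exactly one permutation makes the vector strictly increasing; the
  only term that can survive is the one at the sorted vector.\<close>

lemma indicator_sortvec_eq_sum:
  fixes x :: "nat \<Rightarrow> real"
  assumes dist: "\<And>i j. i < n \<Longrightarrow> j < n \<Longrightarrow> i \<noteq> j \<Longrightarrow> x i \<noteq> x j"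
  defines "S \<equiv> {y \<in> space (PiM {..<n} (\<lambda>_. borel)). \<forall>i<n. \<forall>j<n. i < j \<longrightarrow> y i < y j}"
  shows "indicator A (sortvec n x) = (\<Sum>p | p permutes {..<n}. indicator (A \<inter> S) (\<lambda>i\<in>{..<n}. x (p i)) :: ennreal)"
proof -
  obtain p0 where p0: "p0 permutes {..<n}" "\<And>i. i < n \<Longrightarrow> sortvec n x i = x (p0 i)"
    by (rule sortvec_eq_permute[of n x]) blast
  have in_n: "p i < n" if "p permutes {..<n}" "i < n" for p i
    using permutes_in_image[OF that(1), of i] that(2) by simp
  have eq0: "(\<lambda>i\<in>{..<n}. x (p0 i)) = sortvec n x"
    using p0(2) by (auto simp: fun_eq_iff sortvec_extensional)
  have "sortvec n x i < sortvec n x j" if "i < j" "j < n" for i j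
  proof -
    have "p0 i \<noteq> p0 j" using permutes_inj[OF p0(1)] that(1) by (auto dest: injD)
    then have "x (p0 i) \<noteq> x (p0 j)" using dist in_n[OF p0(1)] that by (meson less_trans)
    then have "sortvec n x i \<noteq> sortvec n x j" using p0(2) that by simp
    moreover have "sortvec n x i \<le> sortvec n x j" using that by (intro sortvec_mono) auto
    ultimately show ?thesis by simp
  qed
  then have S0: "sortvec n x \<in> S" unfolding S_def using sortvec_in_space by auto
  \<comment> \<open>An increasing rearrangement has the values of the sorted vector, and
    distinctness turns equal values into equal indices. From \<open>n\<close> on both permutations
    are the identity.\<close>
  have uniq: "p = p0" if p: "p permutes {..<n}" and S: "(\<lambda>i\<in>{..<n}. x (p i)) \<in> S" for p
  proof
    fix i
    have "x (p i) \<le> x (p j)" if "i < j" "j < n" for i j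
      using S that unfolding S_def by (auto simp: less_imp_le)
    then have "sortvec n x i = x (p i)" if "i < n" using sortvec_unique[OF p] that by blast
    then have "x (p i) = x (p0 i)" if "i < n" using p0(2) that by simp
    then show "p i = p0 i"
      using dist[of "p i" "p0 i"] in_n[OF p, of i] in_n[OF p0(1), of i]
        permutes_not_in[OF p, of i] permutes_not_in[OF p0(1), of i]
      by (cases "i < n") auto
  qed
  have "(\<Sum>p | p permutes {..<n}. indicator (A \<inter> S) (\<lambda>i\<in>{..<n}. x (p i)) :: ennreal)
      = (\<Sum>p | p permutes {..<n}. if p = p0 then indicator A (sortvec n x) else 0)"
  proof (rule sum.cong[OF refl])
    fix p assume "p \<in> {p. p permutes {..<n}}"
    then have p: "p permutes {..<n}" by simp
    show "indicator (A \<inter> S) (\<lambda>i\<in>{..<n}. x (p i)) = (if p = p0 then indicator A (sortvec n x) else (0 :: ennreal))"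
    proof (cases "p = p0")
      case True
      show ?thesis unfolding True eq0 using S0 by (simp add: indicator_def)
    next
      case False
      then have "(\<lambda>i\<in>{..<n}. x (p i)) \<notin> S" using uniq[OF p] by blast
      with False show ?thesis by simp
    qed
  qed
  also have "\<dots> = indicator A (sortvec n x)"
    using p0(1) by (simp add: sum.delta finite_permutations)
  finally show ?thesis ..
qed

text \<open>The difference of two independent normal variables has a density, so it vanishes with
  probability zero; finitely many pairs are involved.\<close>

lemma (in prob_space) AE_distinct_normal:
  fixes n :: nat
  assumes ind: "indep_vars (\<lambda>_. borel) X {..<n}"
    and X: "\<And>i. i < n \<Longrightarrow> distributed M lborel (X i) (\<lambda>x. ennreal (std_normal_density x))"
  shows "AE \<omega> in M. \<forall>i\<in>{..<n}. \<forall>j\<in>{..<n}. i \<noteq> j \<longrightarrow> X i \<omega> \<noteq> X j \<omega>"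
proof -
  have "AE \<omega> in M. X i \<omega> \<noteq> X j \<omega>" if "i < n" "j < n" "i \<noteq> j" for i j
  proof -
    have [measurable]: "X i \<in> borel_measurable M" "X j \<in> borel_measurable M"
      using distributed_measurable[OF X[OF that(1)]] distributed_measurable[OF X[OF that(2)]] by simp_all
    have "indep_var borel (X i) borel (X j)"
      using that by (intro indep_var_pair_of_indep_vars[OF ind]) auto
    then have D: "distributed M lborel (\<lambda>\<omega>. X i \<omega> - X j \<omega>) (normal_density (0 - 0) (sqrt (1\<^sup>2 + 1\<^sup>2)))"
      by (rule diff_indep_normal) (use X that in auto)
    have "emeasure M ((\<lambda>\<omega>. X i \<omega> - X j \<omega>) -` {0} \<inter> space M)
        = (\<integral>\<^sup>+x. ennreal (normal_density (0 - 0) (sqrt (1\<^sup>2 + 1\<^sup>2)) x) * indicator {0} x \<partial>lborel)"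
      by (rule distributed_emeasure[OF D]) simp
    also have "\<dots> = (\<integral>\<^sup>+x. 0 \<partial>(lborel :: real measure))"
      by (rule nn_integral_cong_AE, use AE_lborel_singleton[of "0 :: real"] in eventually_elim) simp
    finally have "emeasure M ((\<lambda>\<omega>. X i \<omega> - X j \<omega>) -` {0} \<inter> space M) = 0" by simp
    then show ?thesis
      by (rule AE_I[rotated]) auto
  qed
  then have "AE \<omega> in M. i \<noteq> j \<longrightarrow> X i \<omega> \<noteq> X j \<omega>" if "i \<in> {..<n}" "j \<in> {..<n}" for i j
    using that by (cases "i = j") auto
  then show ?thesis
    by (intro AE_finite_allI) auto
qed

text \<open>Integrating the indicator identity over the sample space gives \<open>n!\<close> terms.
  By exchangeability they are all equal, each being the unsorted Gaussian mass on the strictly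
  ordered chamber \<open>S\<close>.\<close>

lemma (in prob_space) distributed_sortvec_normal:
  fixes n :: nat
  assumes ind: "indep_vars (\<lambda>_. borel) X {..<n}" and n: "n \<ge> 1"
    and X: "\<And>i. i < n \<Longrightarrow> distributed M lborel (X i) (\<lambda>x. ennreal (std_normal_density x))"
  defines "S \<equiv> {y \<in> space (PiM {..<n} (\<lambda>_. borel)). \<forall>i<n. \<forall>j<n. i < j \<longrightarrow> y i < y j}"
  shows "distributed M (PiM {..<n} (\<lambda>_. lborel)) (\<lambda>\<omega>. sortvec n (\<lambda>i. X i \<omega>))
    (\<lambda>x. ennreal (fact n * indicator S x * (\<Prod>i<n. std_normal_density (x i))))"
proof -
  let ?N = "PiM {..<n} (\<lambda>_. borel :: real measure)"
  let ?L = "PiM {..<n} (\<lambda>_. lborel :: real measure)"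
  let ?P = "PiM {..<n} (\<lambda>_. density lborel (\<lambda>x. ennreal (std_normal_density x)))"
  let ?f = "\<lambda>x. ennreal (fact n * indicator S x * (\<Prod>i<n. std_normal_density (x i)))"
  have setsL: "sets ?L = sets ?N" and setsP: "sets ?P = sets ?N" by (simp_all cong: sets_PiM_cong)
  have [measurable]: "X i \<in> borel_measurable M" if "i \<in> {..<n}" for i
    using distributed_measurable[OF X] that by simp
  have S[measurable]: "S \<in> sets ?N" unfolding S_def by measurable
  then have SL[measurable]: "S \<in> sets ?L" by (simp add: setsL)
  have f[measurable]: "?f \<in> borel_measurable ?L" by measurable
  have V: "(\<lambda>\<omega>. sortvec n (\<lambda>i. X i \<omega>)) \<in> measurable M ?N"
  proof -
    have "(\<lambda>\<omega>. \<lambda>i\<in>{..<n}. sortvec n (\<lambda>i. X i \<omega>) i) \<in> measurable M ?N"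
      by (intro measurable_restrict measurable_sortvec_component) auto
    moreover have "(\<lambda>i\<in>{..<n}. sortvec n x i) = sortvec n x" for x
      by (auto simp: fun_eq_iff sortvec_extensional)
    ultimately show ?thesis by simp
  qed
  then have VL: "(\<lambda>\<omega>. sortvec n (\<lambda>i. X i \<omega>)) \<in> measurable M ?L"
    by (simp cong: measurable_cong_sets add: setsL)
  have lawX: "distr M ?N (\<lambda>\<omega>. \<lambda>i\<in>{..<n}. X i \<omega>) = ?P"
    by (rule distr_indep_normal[OF ind n X])
  have XN: "(\<lambda>\<omega>. \<lambda>i\<in>{..<n}. X i \<omega>) \<in> measurable M ?N" by (intro measurable_restrict) auto
  \<comment> \<open>Exchangeability: a product of identical factors is invariant under permuting
    coordinates.\<close>
  have perm: "emeasure M ((\<lambda>\<omega>. \<lambda>i\<in>{..<n}. X (p i) \<omega>) -` B \<inter> space M) = emeasure ?P B"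
    if p: "p permutes {..<n}" and B: "B \<in> sets ?N" for p B
  proof -
    have pn: "p i \<in> {..<n}" if "i \<in> {..<n}" for i using permutes_in_image[OF p] that by simp
    have re: "(\<lambda>x. \<lambda>i\<in>{..<n}. x (p i)) \<in> measurable ?N ?N"
      using pn by (intro measurable_restrict measurable_component_singleton) auto
    have eq: "(\<lambda>\<omega>. \<lambda>i\<in>{..<n}. X (p i) \<omega>) = (\<lambda>x. \<lambda>i\<in>{..<n}. x (p i)) \<circ> (\<lambda>\<omega>. \<lambda>i\<in>{..<n}. X i \<omega>)"
      using pn by (auto simp: fun_eq_iff)
    have "distr M ?N (\<lambda>\<omega>. \<lambda>i\<in>{..<n}. X (p i) \<omega>) = distr ?P ?N (\<lambda>x. \<lambda>i\<in>{..<n}. x (p i))"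
      unfolding lawX[symmetric] eq by (rule distr_distr[symmetric, OF re XN])
    also have "\<dots> = distr ?P ?P (\<lambda>x. \<lambda>i\<in>{..<n}. x (p i))"
      by (rule distr_cong) (simp_all add: setsP)
    also have "\<dots> = ?P"
      using pn permutes_inj_on[OF p] by (intro distr_PiM_reindex prob_space_normal_density) auto
    finally have "emeasure (distr M ?N (\<lambda>\<omega>. \<lambda>i\<in>{..<n}. X (p i) \<omega>)) B = emeasure ?P B" by simp
    then show ?thesis
      using B measurable_comp[OF XN re] unfolding eq by (simp add: emeasure_distr)
  qed
  have main: "emeasure M ((\<lambda>\<omega>. sortvec n (\<lambda>i. X i \<omega>)) -` A \<inter> space M) = fact n * emeasure ?P (A \<inter> S)"
    if A: "A \<in> sets ?N" for A
  proof -
    have pm: "(\<lambda>\<omega>. \<lambda>i\<in>{..<n}. X (p i) \<omega>) \<in> measurable M ?N" if "p permutes {..<n}" for p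
      using permutes_in_image[OF that] by (intro measurable_restrict) auto
    have AS: "A \<inter> S \<in> sets ?N" using A S by auto
    have "emeasure M ((\<lambda>\<omega>. sortvec n (\<lambda>i. X i \<omega>)) -` A \<inter> space M)
        = (\<integral>\<^sup>+\<omega>. indicator ((\<lambda>\<omega>. sortvec n (\<lambda>i. X i \<omega>)) -` A \<inter> space M) \<omega> \<partial>M)"
      using measurable_sets[OF V A] by simp
    \<comment> \<open>The identity needs distinct entries, hence holds almost everywhere
      only.\<close>
    also have "\<dots> = (\<integral>\<^sup>+\<omega>. (\<Sum>p | p permutes {..<n}. indicator ((\<lambda>\<omega>. \<lambda>i\<in>{..<n}. X (p i) \<omega>) -` (A \<inter> S) \<inter> space M) \<omega>) \<partial>M)"
    proof (rule nn_integral_cong_AE, rule AE_mp[OF AE_distinct_normal[OF ind X] AE_I2[OF impI]])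
      fix \<omega> assume \<omega>: "\<omega> \<in> space M" and "\<forall>i\<in>{..<n}. \<forall>j\<in>{..<n}. i \<noteq> j \<longrightarrow> X i \<omega> \<noteq> X j \<omega>"
      then have "indicator A (sortvec n (\<lambda>i. X i \<omega>))
          = (\<Sum>p | p permutes {..<n}. indicator (A \<inter> S) (\<lambda>i\<in>{..<n}. X (p i) \<omega>) :: ennreal)"
        unfolding S_def by (intro indicator_sortvec_eq_sum) auto
      then show "indicator ((\<lambda>\<omega>. sortvec n (\<lambda>i. X i \<omega>)) -` A \<inter> space M) \<omega>
        = (\<Sum>p | p permutes {..<n}. indicator ((\<lambda>\<omega>. \<lambda>i\<in>{..<n}. X (p i) \<omega>) -` (A \<inter> S) \<inter> space M) \<omega> :: ennreal)"
        using \<omega> by (simp add: indicator_def)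
    qed auto
    also have "\<dots> = (\<Sum>p | p permutes {..<n}. \<integral>\<^sup>+\<omega>. indicator ((\<lambda>\<omega>. \<lambda>i\<in>{..<n}. X (p i) \<omega>) -` (A \<inter> S) \<inter> space M) \<omega> \<partial>M)"
      using measurable_sets[OF pm AS] by (intro nn_integral_sum) auto
    also have "\<dots> = (\<Sum>p | p permutes {..<n}. emeasure ?P (A \<inter> S))"
    proof (rule sum.cong[OF refl])
      fix p assume "p \<in> {p. p permutes {..<n}}"
      then have p: "p permutes {..<n}" by simp
      show "(\<integral>\<^sup>+\<omega>. indicator ((\<lambda>\<omega>. \<lambda>i\<in>{..<n}. X (p i) \<omega>) -` (A \<inter> S) \<inter> space M) \<omega> \<partial>M) = emeasure ?P (A \<inter> S)"
        using perm[OF p AS] measurable_sets[OF pm[OF p] AS] by (subst nn_integral_indicator) auto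
    qed
    also have "\<dots> = fact n * emeasure ?P (A \<inter> S)"
      by (simp add: card_permutations[OF refl] of_nat_fact)
    finally show ?thesis .
  qed
  have "distr M ?L (\<lambda>\<omega>. sortvec n (\<lambda>i. X i \<omega>)) = density ?L ?f"
  proof (rule measure_eqI)
    fix A assume "A \<in> sets (distr M ?L (\<lambda>\<omega>. sortvec n (\<lambda>i. X i \<omega>)))"
    then have A: "A \<in> sets ?L" and AN: "A \<in> sets ?N" by (simp_all add: setsL)
    have "emeasure (distr M ?L (\<lambda>\<omega>. sortvec n (\<lambda>i. X i \<omega>))) A = fact n * emeasure ?P (A \<inter> S)"
      using A VL main[OF AN] by (simp add: emeasure_distr)
    also have "\<dots> = fact n * (\<integral>\<^sup>+x. (\<Prod>i<n. ennreal (std_normal_density (x i))) * indicator (A \<inter> S) x \<partial>?L)"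
      unfolding PiM_normal_density[OF zero_less_one] using A SL by (subst emeasure_density) auto
    also have "\<dots> = (\<integral>\<^sup>+x. fact n * ((\<Prod>i<n. ennreal (std_normal_density (x i))) * indicator (A \<inter> S) x) \<partial>?L)"
      using A SL by (intro nn_integral_cmult[symmetric]) auto
    also have "\<dots> = (\<integral>\<^sup>+x. ?f x * indicator A x \<partial>?L)"
      by (intro nn_integral_cong) (auto simp: indicator_def prod_ennreal ennreal_mult prod_nonneg simp flip: ennreal_fact)
    also have "\<dots> = emeasure (density ?L ?f) A"
      using A by (subst emeasure_density) auto
    finally show "emeasure (distr M ?L (\<lambda>\<omega>. sortvec n (\<lambda>i. X i \<omega>))) A = emeasure (density ?L ?f) A" .
  qed simp
  then show ?thesis unfolding distributed_def using VL by simp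
qed

text \<open>On \<open>S\<close> the log-density is the Gaussian one plus \<open>ln (fact n)\<close>.
  Its quadratic part is symmetric, so sorted entries can be replaced by the original ones and the
  second moments finish the computation.\<close>

lemma (in prob_space) diff_entropy_sortvec_normal:
  fixes n :: nat
  assumes ind: "indep_vars (\<lambda>_. borel) X {..<n}" and n: "n \<ge> 1"
    and X: "\<And>i. i < n \<Longrightarrow> distributed M lborel (X i) (\<lambda>x. ennreal (std_normal_density x))"
    and X2: "\<And>i. i < n \<Longrightarrow> integrable M (\<lambda>\<omega>. (X i \<omega>)\<^sup>2)" "\<And>i. i < n \<Longrightarrow> expectation (\<lambda>\<omega>. (X i \<omega>)\<^sup>2) = 1"
  shows "diff_entropy M n (\<lambda>\<omega>. sortvec n (\<lambda>i. X i \<omega>)) = real n / 2 * ln (2 * pi * exp 1) - ln (fact n)"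
proof -
  interpret information_space M "exp 1" by unfold_locales simp
  let ?L = "PiM {..<n} (\<lambda>_. lborel :: real measure)"
  define S where "S = {y \<in> space (PiM {..<n} (\<lambda>_. borel)). \<forall>i<n. \<forall>j<n. i < j \<longrightarrow> y i < (y j :: real)}"
  define f where "f = (\<lambda>x. fact n * indicator S x * (\<Prod>i<n. std_normal_density (x i)))"
  have D: "distributed M ?L (\<lambda>\<omega>. sortvec n (\<lambda>i. X i \<omega>)) (\<lambda>x. ennreal (f x))"
    unfolding f_def S_def by (rule distributed_sortvec_normal[OF ind n X])
  have nn: "0 \<le> f x" for x unfolding f_def by (intro mult_nonneg_nonneg prod_nonneg) auto
  have fm[measurable]: "f \<in> borel_measurable ?L" by (rule distributed_real_measurable[OF nn D])
  have ae: "AE \<omega> in M. ln (f (sortvec n (\<lambda>i. X i \<omega>))) = ln (fact n) - real n / 2 * ln (2 * pi) - (\<Sum>i<n. (X i \<omega>)\<^sup>2) / 2"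
  proof (rule AE_mp[OF AE_distinct_normal[OF ind X] AE_I2[OF impI]])
    fix \<omega> assume "\<forall>i\<in>{..<n}. \<forall>j\<in>{..<n}. i \<noteq> j \<longrightarrow> X i \<omega> \<noteq> X j \<omega>"
    then have dist: "\<And>i j. i < n \<Longrightarrow> j < n \<Longrightarrow> i \<noteq> j \<Longrightarrow> X i \<omega> \<noteq> X j \<omega>" by auto
    define v where "v = sortvec n (\<lambda>i. X i \<omega>)"
    \<comment> \<open>Applied to the set \<open>{v}\<close>, the indicator identity has left side
      one; were \<open>v\<close> outside \<open>S\<close>, every summand on the right would
      vanish.\<close>
    have "v \<in> S"
    proof (rule ccontr)
      assume "v \<notin> S"
      have "(1::ennreal) = indicator {v} v" by simp
      also have "\<dots> = (\<Sum>p | p permutes {..<n}. indicator ({v} \<inter> S) (\<lambda>i\<in>{..<n}. X (p i) \<omega>))"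
        unfolding v_def S_def by (rule indicator_sortvec_eq_sum) (use dist in auto)
      also have "{v} \<inter> S = {}" using \<open>v \<notin> S\<close> by simp
      finally show False by simp
    qed
    then have "f v = fact n * (\<Prod>i<n. std_normal_density (v i))" unfolding f_def by simp
    moreover have "(\<Prod>i<n. std_normal_density (v i)) > 0"
      by (intro prod_pos) (simp add: normal_density_pos)
    ultimately have "ln (f v) = ln (fact n) + ln (\<Prod>i<n. std_normal_density (v i))"
      using ln_mult_pos[of "fact n" "\<Prod>i<n. std_normal_density (v i)"] by simp
    also have "(\<Prod>i<n. std_normal_density (v i)) = (1 / sqrt (2 * pi)) ^ n * exp (- (\<Sum>i<n. (v i)\<^sup>2) / 2)"
      unfolding std_normal_density_def prod.distrib by (simp add: exp_sum[symmetric] sum_negf sum_divide_distrib)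
    also have "ln \<dots> = - (real n / 2 * ln (2 * pi)) - (\<Sum>i<n. (v i)\<^sup>2) / 2"
      by (simp add: ln_mult ln_realpow ln_div ln_sqrt)
    also have "(\<Sum>i<n. (v i)\<^sup>2) = (\<Sum>i<n. (X i \<omega>)\<^sup>2)"
      unfolding v_def by (rule sum_sortvec)
    finally show "ln (f (sortvec n (\<lambda>i. X i \<omega>))) = ln (fact n) - real n / 2 * ln (2 * pi) - (\<Sum>i<n. (X i \<omega>)\<^sup>2) / 2"
      unfolding v_def by simp
  qed
  have "entropy (exp 1) ?L (\<lambda>\<omega>. sortvec n (\<lambda>i. X i \<omega>)) = - (\<integral>x. f x * log (exp 1) (f x) \<partial>?L)"
    by (rule entropy_distr[OF D nn])
  also have "(\<integral>x. f x * log (exp 1) (f x) \<partial>?L) = (\<integral>x. f x * ln (f x) \<partial>?L)"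
    by (simp add: log_def)
  \<comment> \<open>The integral against the density becomes an expectation at the sorted vector
    itself, where \<open>ae\<close> applies.\<close>
  also have "\<dots> = expectation (\<lambda>\<omega>. ln (f (sortvec n (\<lambda>i. X i \<omega>))))"
    by (rule distributed_integral[OF D _ nn]) measurable
  also have "\<dots> = expectation (\<lambda>\<omega>. ln (fact n) - real n / 2 * ln (2 * pi) - (\<Sum>i<n. (X i \<omega>)\<^sup>2) / 2)"
  proof (rule integral_cong_AE[OF _ _ ae])
    show "(\<lambda>\<omega>. ln (f (sortvec n (\<lambda>i. X i \<omega>)))) \<in> borel_measurable M"
      using distributed_measurable[OF D] by measurable
    show "(\<lambda>\<omega>. ln (fact n) - real n / 2 * ln (2 * pi) - (\<Sum>i<n. (X i \<omega>)\<^sup>2) / 2) \<in> borel_measurable M"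
      using X2(1)[THEN borel_measurable_integrable] by measurable
  qed
  also have "\<dots> = ln (fact n) - real n / 2 * ln (2 * pi) - real n / 2"
  proof -
    have I: "integrable M (\<lambda>\<omega>. \<Sum>i<n. (X i \<omega>)\<^sup>2)"
      by (rule Bochner_Integration.integrable_sum) (use X2(1) in simp)
    have "expectation (\<lambda>\<omega>. \<Sum>i<n. (X i \<omega>)\<^sup>2) = real n"
      using X2 by (subst Bochner_Integration.integral_sum) auto
    then show ?thesis using I by (simp add: prob_space)
  qed
  finally show ?thesis
    unfolding diff_entropy_def by (simp add: ln_mult field_simps)
qed

section \<open>The Gaussian channel\<close>

lemma (in prob_space)
  assumes s: "s > 0" and X: "distributed M lborel X (\<lambda>x. ennreal (normal_density 0 s x))"
  shows integrable_normal_power2: "integrable M (\<lambda>\<omega>. (X \<omega>)\<^sup>2)"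
    and integrable_normal: "integrable M X"
    and expectation_normal_power2: "expectation (\<lambda>\<omega>. (X \<omega>)\<^sup>2) = s\<^sup>2"
proof -
  have [measurable]: "X \<in> borel_measurable M" using distributed_measurable[OF X] by simp
  show X2: "integrable M (\<lambda>\<omega>. (X \<omega>)\<^sup>2)"
    using integrable_normal_moment[OF s, of 0 2] distributed_integrable[OF X, of "\<lambda>x. x\<^sup>2"] by simp
  show "integrable M X" by (rule square_integrable_imp_integrable) (use X2 in auto)
  show "expectation (\<lambda>\<omega>. (X \<omega>)\<^sup>2) = s\<^sup>2"
    using normal_distributed_variance[OF s X] normal_distributed_expectation[OF s X] by simp
qed

text \<open>The channel at one fixed noise level. The sum-type index makes all \<open>2 * n\<close>
  coordinates of signal and noise jointly independent, so \<open>X + \<sigma> * Z\<close> has the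
  required conditional law given \<open>X\<close>.\<close>

locale gaussian_channel = prob_space M for M :: "'a measure" +
  fixes n :: nat and X Z :: "nat \<Rightarrow> 'a \<Rightarrow> real" and \<sigma> :: real
  assumes n: "n \<ge> 1" and \<sigma>: "\<sigma> > 0"
    and indep: "indep_vars (\<lambda>_. borel) (\<lambda>k. case k of Inl i \<Rightarrow> X i | Inr i \<Rightarrow> Z i) (Inl ` {..<n} \<union> Inr ` {..<n})"
    and X: "\<And>i. i < n \<Longrightarrow> distributed M lborel (X i) (\<lambda>x. ennreal (std_normal_density x))"
    and Z: "\<And>i. i < n \<Longrightarrow> distributed M lborel (Z i) (\<lambda>x. ennreal (std_normal_density x))"
begin

text \<open>\<open>W i\<close> is the residual \<open>X i - E[X i | Y]\<close>, and \<open>s\<close> its standard deviation.\<close>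

definition "Y = (\<lambda>i \<omega>. X i \<omega> + \<sigma> * Z i \<omega>)"
definition "W = (\<lambda>i \<omega>. X i \<omega> - Y i \<omega> / (1 + \<sigma>\<^sup>2))"
definition "s = \<sigma> / sqrt (1 + \<sigma>\<^sup>2)"
definition "SX = (\<lambda>i \<omega>. sortvec n (\<lambda>j. X j \<omega>) i)"
definition "FY = gen_sigma M n (\<lambda>\<omega> i. Y i \<omega>)"
definition "FS = gen_sigma M n (\<lambda>\<omega>. sortvec n (\<lambda>i. Y i \<omega>))"

lemma one_plus_pos: "1 + \<sigma>\<^sup>2 > 0" by (simp add: add_pos_nonneg)

lemma s_pos: "s > 0" unfolding s_def using \<sigma> one_plus_pos by simp

lemma s_power2: "s\<^sup>2 = \<sigma>\<^sup>2 / (1 + \<sigma>\<^sup>2)"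
  unfolding s_def using one_plus_pos by (simp add: power_divide)

lemma indep_XZ: "indep_vars (\<lambda>_. borel \<Otimes>\<^sub>M borel) (\<lambda>i \<omega>. (X i \<omega>, Z i \<omega>)) {..<n}"
  by (rule indep_vars_pairing[OF indep])

lemma indep_var_XZ: "i < n \<Longrightarrow> indep_var borel (X i) borel (Z i)"
  using indep_var_pair_of_indep_vars[OF indep, of "Inl i" "Inr i"] by simp

lemma indep_X: "indep_vars (\<lambda>_. borel) X {..<n}"
  using indep_vars_compose2[OF indep_XZ, of "\<lambda>_. fst" "\<lambda>_. borel"] by simp

lemma indep_WY: "indep_vars (\<lambda>_. borel \<Otimes>\<^sub>M borel) (\<lambda>i \<omega>. (W i \<omega>, Y i \<omega>)) {..<n}"
  using indep_vars_compose2[OF indep_XZ, of "\<lambda>_ (x, z). (x - (x + \<sigma> * z) / (1 + \<sigma>\<^sup>2), x + \<sigma> * z)" "\<lambda>_. borel \<Otimes>\<^sub>M borel"]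
  by (simp add: W_def Y_def)

lemma indep_W: "indep_vars (\<lambda>_. borel) W {..<n}"
  using indep_vars_compose2[OF indep_WY, of "\<lambda>_. fst" "\<lambda>_. borel"] by simp

lemma distributed_W: "i < n \<Longrightarrow> distributed M lborel (W i) (\<lambda>x. ennreal (normal_density 0 s x))"
  unfolding W_def Y_def s_def by (rule distributed_gaussian_residual[OF indep_var_XZ \<sigma> X Z])

lemma distributed_Y: "i < n \<Longrightarrow> distributed M lborel (Y i) (\<lambda>x. ennreal (normal_density 0 (sqrt (1 + \<sigma>\<^sup>2)) x))"
  unfolding Y_def by (rule distributed_gaussian_observation[OF indep_var_XZ \<sigma> X Z])

lemma measurable_channel[measurable]:
  assumes "i < n"
  shows "X i \<in> borel_measurable M" "Y i \<in> borel_measurable M" "W i \<in> borel_measurable M"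
  using distributed_measurable[OF X[OF assms]] distributed_measurable[OF distributed_Y[OF assms]]
    distributed_measurable[OF distributed_W[OF assms]] by simp_all

lemma moments_X: "i < n \<Longrightarrow> integrable M (\<lambda>\<omega>. (X i \<omega>)\<^sup>2)" "i < n \<Longrightarrow> integrable M (X i)"
    "i < n \<Longrightarrow> expectation (\<lambda>\<omega>. (X i \<omega>)\<^sup>2) = 1"
  using integrable_normal_power2[OF _ X] integrable_normal[OF _ X] expectation_normal_power2[OF _ X] by auto

lemma moments_Y: "i < n \<Longrightarrow> integrable M (\<lambda>\<omega>. (Y i \<omega>)\<^sup>2)" "i < n \<Longrightarrow> integrable M (Y i)"
    "i < n \<Longrightarrow> expectation (\<lambda>\<omega>. (Y i \<omega>)\<^sup>2) = 1 + \<sigma>\<^sup>2"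
  using integrable_normal_power2[OF _ distributed_Y] integrable_normal[OF _ distributed_Y]
    expectation_normal_power2[OF _ distributed_Y] one_plus_pos by auto

lemma moments_W: "i < n \<Longrightarrow> integrable M (\<lambda>\<omega>. (W i \<omega>)\<^sup>2)" "i < n \<Longrightarrow> integrable M (W i)"
    "i < n \<Longrightarrow> expectation (\<lambda>\<omega>. (W i \<omega>)\<^sup>2) = s\<^sup>2" "i < n \<Longrightarrow> expectation (W i) = 0"
  using integrable_normal_power2[OF s_pos distributed_W] integrable_normal[OF s_pos distributed_W]
    expectation_normal_power2[OF s_pos distributed_W] normal_distributed_expectation[OF s_pos distributed_W] by auto

text \<open>Independence of \<open>W i\<close> and \<open>Y i\<close> at each index comes from the
  rotation and is lifted here to the whole vectors.\<close>

lemma indep_W_FY: "indep_subalgebra M (PiM {..<n} (\<lambda>_. borel)) (\<lambda>\<omega>. \<lambda>i\<in>{..<n}. W i \<omega>) FY"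
  unfolding FY_def
proof (rule indep_subalgebra_gen_sigma, rule indep_vars_split_pairs[OF indep_WY])
  show "{..<n} \<noteq> {}" using n by (auto simp: lessThan_empty_iff)
  show "prob {\<omega> \<in> space M. W i \<omega> \<in> A \<and> Y i \<omega> \<in> B} = prob (W i -` A \<inter> space M) * prob (Y i -` B \<inter> space M)"
    if "i \<in> {..<n}" "A \<in> sets borel" "B \<in> sets borel" for i A B
    using prob_residual_observation[OF indep_var_XZ \<sigma> X Z that(2,3)] that(1) unfolding W_def Y_def by auto
qed simp

lemma subalgebra_FY: "subalgebra M FY"
  using indep_W_FY by (simp add: indep_subalgebra_def)

lemma subalgebra_FS: "subalgebra M FS"
  unfolding FS_def by (rule subalgebra_gen_sigma) (auto intro!: measurable_sortvec_component)

lemma measurable_Y_FY: "i < n \<Longrightarrow> Y i \<in> borel_measurable FY"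
  unfolding FY_def using measurable_gen_sigma[of i n "\<lambda>\<omega> i. Y i \<omega>" M] by simp

text \<open>Sorted \<open>Y\<close> is a measurable function of \<open>Y\<close>. Hence
  \<open>W\<close> is independent of \<open>FS\<close> too, and estimators built from sorted
  \<open>Y\<close> count as functions of \<open>Y\<close>.\<close>

lemma FS_sub_FY: "sets FS \<subseteq> sets FY"
  unfolding FS_def
  by (rule gen_sigma_sub)
     (use measurable_Y_FY subalgebra_FY in \<open>auto intro!: measurable_sortvec_component simp: subalgebra_def\<close>)

lemma indep_W_FS: "indep_subalgebra M (PiM {..<n} (\<lambda>_. borel)) (\<lambda>\<omega>. \<lambda>i\<in>{..<n}. W i \<omega>) FS"
  by (rule indep_subalgebra_mono[OF indep_W_FY FS_sub_FY]) (use subalgebra_FS in \<open>simp add: subalgebra_def\<close>)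

text \<open>Write \<open>X i\<close> as \<open>W i + Y i / (1 + \<sigma>\<^sup>2)\<close>: the
  second term is \<open>FY\<close>-measurable, and the first is centred and independent of
  \<open>FY\<close>, so its integral over every set of \<open>FY\<close> is zero.\<close>

lemma cond_exp_X:
  assumes i: "i < n"
  shows "AE \<omega> in M. real_cond_exp M FY (X i) \<omega> = Y i \<omega> / (1 + \<sigma>\<^sup>2)"
proof -
  interpret finite_measure_subalgebra M FY using subalgebra_FY by unfold_locales
  note [measurable] = measurable_channel[OF i]
  show ?thesis
  proof (rule real_cond_exp_charact)
    fix A assume A: "A \<in> sets FY"
    then have AM[measurable]: "A \<in> sets M" using subalgebra_FY by (auto simp: subalgebra_def)
    have "indep_subalgebra M borel (\<lambda>\<omega>. (\<lambda>w. w i) (\<lambda>i\<in>{..<n}. W i \<omega>)) FY"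
      by (rule indep_subalgebra_compose[OF indep_W_FY]) (use i in auto)
    then have "indep_subalgebra M borel (W i) FY" using i by simp
    then have "indep_var borel (W i) borel (indicator A :: 'a \<Rightarrow> real)"
      by (rule indep_subalgebra_imp_indep_var) (use A in simp)
    then have "expectation (\<lambda>\<omega>. W i \<omega> * indicator A \<omega>) = 0"
      and I: "integrable M (\<lambda>\<omega>. W i \<omega> * indicator A \<omega>)"
      using indep_var_lebesgue_integral[of "W i" "indicator A"] indep_var_integrable[of "W i" "indicator A"]
        moments_W[OF i] AM by (simp_all add: emeasure_eq_measure)
    moreover have "integrable M (\<lambda>\<omega>. indicator A \<omega> * (Y i \<omega> / (1 + \<sigma>\<^sup>2)))"
      by (rule integrable_real_mult_indicator[of A M "\<lambda>\<omega>. Y i \<omega> / (1 + \<sigma>\<^sup>2)", unfolded mult.commute[of _ "indicator _ _"]])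
        (use moments_Y[OF i] in auto)
    moreover have "indicator A \<omega> * X i \<omega> = W i \<omega> * indicator A \<omega> + indicator A \<omega> * (Y i \<omega> / (1 + \<sigma>\<^sup>2))" for \<omega>
      by (simp add: W_def algebra_simps)
    ultimately show "(\<integral>\<omega>\<in>A. X i \<omega> \<partial>M) = (\<integral>\<omega>\<in>A. Y i \<omega> / (1 + \<sigma>\<^sup>2) \<partial>M)"
      unfolding set_lebesgue_integral_def by simp
  qed (use moments_X[OF i] moments_Y[OF i] measurable_Y_FY[OF i] in auto)
qed

section \<open>Mean square errors with and without sorting\<close>

lemma mmse_unsorted: "mmse M n (\<lambda>\<omega> i. X i \<omega>) (\<lambda>\<omega> i. Y i \<omega>) = real n * \<sigma>\<^sup>2 / (1 + \<sigma>\<^sup>2)"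
proof -
  have "AE \<omega> in M. \<forall>i\<in>{..<n}. real_cond_exp M FY (X i) \<omega> = Y i \<omega> / (1 + \<sigma>\<^sup>2)"
    by (rule AE_finite_allI) (auto intro: cond_exp_X)
  then have ae: "AE \<omega> in M. (\<Sum>i<n. (X i \<omega> - real_cond_exp M FY (X i) \<omega>)\<^sup>2) = (\<Sum>i<n. (W i \<omega>)\<^sup>2)"
    by eventually_elim (simp add: W_def)
  have "mmse M n (\<lambda>\<omega> i. X i \<omega>) (\<lambda>\<omega> i. Y i \<omega>) = expectation (\<lambda>\<omega>. \<Sum>i<n. (X i \<omega> - real_cond_exp M FY (X i) \<omega>)\<^sup>2)"
    by (simp add: mmse_def FY_def)
  also have "\<dots> = expectation (\<lambda>\<omega>. \<Sum>i<n. (W i \<omega>)\<^sup>2)"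
    by (rule integral_cong_AE[OF _ _ ae]) (auto intro!: borel_measurable_sum borel_measurable_power borel_measurable_diff)
  also have "\<dots> = (\<Sum>i<n. expectation (\<lambda>\<omega>. (W i \<omega>)\<^sup>2))"
    by (rule Bochner_Integration.integral_sum) (use moments_W in auto)
  also have "\<dots> = real n * s\<^sup>2" using moments_W by simp
  finally show ?thesis by (simp add: s_power2)
qed

lemma measurable_SX[measurable]: "i < n \<Longrightarrow> SX i \<in> borel_measurable M"
  unfolding SX_def by (rule measurable_sortvec_component) auto

text \<open>One square is at most the sum of all squares, which sorting leaves unchanged.\<close>

lemma integrable_sortvec_power2:
  assumes "i < n" and [measurable]: "\<And>j. j < n \<Longrightarrow> U j \<in> borel_measurable M"
    and U: "\<And>j. j < n \<Longrightarrow> integrable M (\<lambda>\<omega>. (U j \<omega>)\<^sup>2)"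
  shows "integrable M (\<lambda>\<omega>. (sortvec n (\<lambda>j. U j \<omega>) i)\<^sup>2)"
proof (rule Bochner_Integration.integrable_bound)
  show "integrable M (\<lambda>\<omega>. \<Sum>j<n. (U j \<omega>)\<^sup>2)"
    by (rule Bochner_Integration.integrable_sum) (use U in auto)
  show "(\<lambda>\<omega>. (sortvec n (\<lambda>j. U j \<omega>) i)\<^sup>2) \<in> borel_measurable M"
    by (intro borel_measurable_power measurable_sortvec_component) (use assms in auto)
  have "(sortvec n (\<lambda>j. U j \<omega>) i)\<^sup>2 \<le> (\<Sum>j<n. (U j \<omega>)\<^sup>2)" for \<omega>
  proof -
    have "(sortvec n (\<lambda>j. U j \<omega>) i)\<^sup>2 \<le> (\<Sum>k<n. (sortvec n (\<lambda>j. U j \<omega>) k)\<^sup>2)"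
      using assms(1) by (intro member_le_sum) auto
    also have "\<dots> = (\<Sum>j<n. (U j \<omega>)\<^sup>2)" by (rule sum_sortvec)
    finally show ?thesis .
  qed
  then show "AE \<omega> in M. norm ((sortvec n (\<lambda>j. U j \<omega>) i)\<^sup>2) \<le> norm (\<Sum>j<n. (U j \<omega>)\<^sup>2)"
    by (auto simp: sum_nonneg)
qed

lemma integrable_SX2: "i < n \<Longrightarrow> integrable M (\<lambda>\<omega>. (SX i \<omega>)\<^sup>2)"
  unfolding SX_def by (rule integrable_sortvec_power2) (auto simp: moments_X)

lemma integrable_error:
  assumes "i < n"
  shows "integrable M (\<lambda>\<omega>. (SX i \<omega> - real_cond_exp M FS (SX i) \<omega>)\<^sup>2)"
  by (rule integrable_power2_diff)
     (use assms in \<open>auto simp: integrable_SX2 intro!: integrable_cond_exp_power2 subalgebra_FS\<close>)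

lemma mmse_sorted_eq:
  "mmse M n (\<lambda>\<omega>. sortvec n (\<lambda>i. X i \<omega>)) (\<lambda>\<omega>. sortvec n (\<lambda>i. Y i \<omega>))
    = expectation (\<lambda>\<omega>. \<Sum>i<n. (SX i \<omega> - real_cond_exp M FS (SX i) \<omega>)\<^sup>2)"
  by (simp add: mmse_def SX_def FS_def)

text \<open>The general bound is used with shift \<open>Y / (1 + \<sigma>\<^sup>2)\<close>, which
  restores \<open>X\<close> from \<open>W\<close>, and with the conditional mean given
  \<open>FS\<close> as guess; the latter is admissible because it is
  \<open>FY\<close>-measurable.\<close>

lemma mmse_sorted_ge:
  "real n * s\<^sup>2 / fact n powr (2 / real n)
    \<le> mmse M n (\<lambda>\<omega>. sortvec n (\<lambda>i. X i \<omega>)) (\<lambda>\<omega>. sortvec n (\<lambda>i. Y i \<omega>))"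
proof -
  have sum: "W j \<omega> + Y j \<omega> / (1 + \<sigma>\<^sup>2) = X j \<omega>" for j \<omega> by (simp add: W_def)
  have "real n * s\<^sup>2 / fact n powr (2 / real n)
    \<le> expectation (\<lambda>\<omega>. \<Sum>i<n. (sortvec n (\<lambda>j. W j \<omega> + Y j \<omega> / (1 + \<sigma>\<^sup>2)) i - real_cond_exp M FS (SX i) \<omega>)\<^sup>2)"
  proof (rule expectation_sortvec_error_ge[OF n s_pos indep_W_FY])
    show "distr M (PiM {..<n} (\<lambda>_. borel)) (\<lambda>\<omega>. \<lambda>i\<in>{..<n}. W i \<omega>)
      = density (PiM {..<n} (\<lambda>_. lborel)) (\<lambda>w. \<Prod>i<n. ennreal (normal_density 0 s (w i)))"
      unfolding PiM_normal_density[OF s_pos, symmetric] by (rule distr_indep_normal[OF indep_W n distributed_W])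
    fix i assume i: "i < n"
    show "(\<lambda>\<omega>. Y i \<omega> / (1 + \<sigma>\<^sup>2)) \<in> borel_measurable FY" using measurable_Y_FY[OF i] by measurable
    show "real_cond_exp M FS (SX i) \<in> borel_measurable FY"
      by (rule measurable_from_subalg[of FY FS])
         (use subalgebra_FS subalgebra_FY FS_sub_FY in \<open>auto simp: subalgebra_def\<close>)
    show "integrable M (\<lambda>\<omega>. (W i \<omega>)\<^sup>2)" "expectation (\<lambda>\<omega>. (W i \<omega>)\<^sup>2) = s\<^sup>2" using moments_W i by auto
    show "integrable M (\<lambda>\<omega>. (sortvec n (\<lambda>j. W j \<omega> + Y j \<omega> / (1 + \<sigma>\<^sup>2)) i - real_cond_exp M FS (SX i) \<omega>)\<^sup>2)"
      unfolding sum using integrable_error[OF i] by (simp add: SX_def)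
  qed
  then show ?thesis unfolding sum mmse_sorted_eq by (simp add: SX_def)
qed

text \<open>By Pythagoras the gap between variance and error is the variance of the conditional
  mean. Each coordinate contributes at most the mean square distance to a variable independent of
  \<open>FS\<close>, which is bounded by \<open>n / (1 + \<sigma>\<^sup>2)\<close>; summing gives
  the factor \<open>n\<^sup>2\<close>.\<close>

lemma
  shows mmse_sorted_le_vvar:
    "mmse M n (\<lambda>\<omega>. sortvec n (\<lambda>i. X i \<omega>)) (\<lambda>\<omega>. sortvec n (\<lambda>i. Y i \<omega>)) \<le> vvar M n (\<lambda>\<omega>. sortvec n (\<lambda>i. X i \<omega>))"
    and vvar_le_mmse_sorted: "vvar M n (\<lambda>\<omega>. sortvec n (\<lambda>i. X i \<omega>)) - (real n)\<^sup>2 / (1 + \<sigma>\<^sup>2)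
      \<le> mmse M n (\<lambda>\<omega>. sortvec n (\<lambda>i. X i \<omega>)) (\<lambda>\<omega>. sortvec n (\<lambda>i. Y i \<omega>))"
proof -
  let ?g = "\<lambda>i. real_cond_exp M FS (SX i)"
  have m: "mmse M n (\<lambda>\<omega>. sortvec n (\<lambda>i. X i \<omega>)) (\<lambda>\<omega>. sortvec n (\<lambda>i. Y i \<omega>))
      = (\<Sum>i<n. expectation (\<lambda>\<omega>. (SX i \<omega> - ?g i \<omega>)\<^sup>2))"
    unfolding mmse_sorted_eq by (rule Bochner_Integration.integral_sum) (use integrable_error in auto)
  have "vvar M n (\<lambda>\<omega>. sortvec n (\<lambda>i. X i \<omega>)) = expectation (\<lambda>\<omega>. \<Sum>i<n. (SX i \<omega> - expectation (SX i))\<^sup>2)"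
    by (simp add: vvar_def SX_def)
  also have "\<dots> = (\<Sum>i<n. expectation (\<lambda>\<omega>. (SX i \<omega> - expectation (SX i))\<^sup>2))"
    by (rule Bochner_Integration.integral_sum, rule integrable_power2_diff) (auto simp: integrable_SX2)
  finally have v: "vvar M n (\<lambda>\<omega>. sortvec n (\<lambda>i. X i \<omega>)) = (\<Sum>i<n. expectation (\<lambda>\<omega>. (SX i \<omega> - expectation (SX i))\<^sup>2))" .
  have pyth: "expectation (\<lambda>\<omega>. (SX i \<omega> - expectation (SX i))\<^sup>2)
      = expectation (\<lambda>\<omega>. (SX i \<omega> - ?g i \<omega>)\<^sup>2) + expectation (\<lambda>\<omega>. (?g i \<omega> - expectation (SX i))\<^sup>2)" if "i < n" for i
    by (rule cond_exp_pythagoras[OF subalgebra_FS]) (use that in \<open>auto simp: integrable_SX2\<close>)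
  show "mmse M n (\<lambda>\<omega>. sortvec n (\<lambda>i. X i \<omega>)) (\<lambda>\<omega>. sortvec n (\<lambda>i. Y i \<omega>)) \<le> vvar M n (\<lambda>\<omega>. sortvec n (\<lambda>i. X i \<omega>))"
    unfolding m v by (rule sum_mono) (use pyth in auto)
  have small: "expectation (\<lambda>\<omega>. (?g i \<omega> - expectation (SX i))\<^sup>2) \<le> real n / (1 + \<sigma>\<^sup>2)" if i: "i < n" for i
  proof -
    \<comment> \<open>The comparison variable is the order statistic of the residuals: independent
      of \<open>FS\<close>, and close to that of \<open>X\<close> when the noise is large.\<close>
    define T where "T = (\<lambda>\<omega>. sortvec n (\<lambda>j. W j \<omega>) i)"
    have "indep_subalgebra M borel (\<lambda>\<omega>. (\<lambda>w. sortvec n w i) (\<lambda>i\<in>{..<n}. W i \<omega>)) FS"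
      by (rule indep_subalgebra_compose[OF indep_W_FS]) (use i in \<open>auto intro!: measurable_sortvec_component\<close>)
    moreover have "sortvec n (\<lambda>i\<in>{..<n}. W i \<omega>) = sortvec n (\<lambda>j. W j \<omega>)" for \<omega>
      by (rule sortvec_cong) simp
    ultimately have ind: "indep_subalgebra M borel T FS" unfolding T_def by simp
    have T2: "integrable M (\<lambda>\<omega>. (T \<omega>)\<^sup>2)"
      unfolding T_def by (rule integrable_sortvec_power2[OF i]) (auto simp: moments_W)
    have IY: "integrable M (\<lambda>\<omega>. (Y j \<omega> / (1 + \<sigma>\<^sup>2))\<^sup>2)" if "j < n" for j
      using moments_Y(1)[OF that] by (simp add: power_divide)
    have "expectation (\<lambda>\<omega>. (?g i \<omega> - expectation (SX i))\<^sup>2) \<le> expectation (\<lambda>\<omega>. (SX i \<omega> - T \<omega>)\<^sup>2)"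
      by (rule cond_exp_variance_le[OF subalgebra_FS _ _ ind T2]) (use i in \<open>auto simp: integrable_SX2\<close>)
    also have "\<dots> \<le> expectation (\<lambda>\<omega>. \<Sum>j<n. (Y j \<omega> / (1 + \<sigma>\<^sup>2))\<^sup>2)"
    proof (rule integral_mono)
      show "integrable M (\<lambda>\<omega>. (SX i \<omega> - T \<omega>)\<^sup>2)"
        by (rule integrable_power2_diff)
           (use i T2 ind in \<open>auto simp: integrable_SX2 indep_subalgebra_def\<close>)
      show "integrable M (\<lambda>\<omega>. \<Sum>j<n. (Y j \<omega> / (1 + \<sigma>\<^sup>2))\<^sup>2)"
        by (rule Bochner_Integration.integrable_sum) (use IY in auto)
      fix \<omega>
      \<comment> \<open>The Euclidean norm of the shift serves as a bound on its maximum norm, since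
        its square is easy to integrate.\<close>
      let ?d = "sqrt (\<Sum>j<n. (Y j \<omega> / (1 + \<sigma>\<^sup>2))\<^sup>2)"
      have "\<bar>SX i \<omega> - T \<omega>\<bar> \<le> ?d"
        unfolding SX_def T_def
      proof (rule sortvec_lipschitz[OF i])
        fix j assume "j < n"
        then have "(Y j \<omega> / (1 + \<sigma>\<^sup>2))\<^sup>2 \<le> (\<Sum>j<n. (Y j \<omega> / (1 + \<sigma>\<^sup>2))\<^sup>2)"
          by (intro member_le_sum) auto
        then have "\<bar>Y j \<omega> / (1 + \<sigma>\<^sup>2)\<bar> \<le> ?d"
          by (metis real_sqrt_abs real_sqrt_le_mono)
        moreover have "X j \<omega> - W j \<omega> = Y j \<omega> / (1 + \<sigma>\<^sup>2)" by (simp add: W_def)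
        ultimately show "\<bar>X j \<omega> - W j \<omega>\<bar> \<le> ?d" by simp
      qed
      then have "\<bar>SX i \<omega> - T \<omega>\<bar>\<^sup>2 \<le> ?d\<^sup>2" by (rule power_mono) simp
      then show "(SX i \<omega> - T \<omega>)\<^sup>2 \<le> (\<Sum>j<n. (Y j \<omega> / (1 + \<sigma>\<^sup>2))\<^sup>2)"
        by (simp add: sum_nonneg)
    qed
    also have "\<dots> = (\<Sum>j<n. expectation (\<lambda>\<omega>. (Y j \<omega> / (1 + \<sigma>\<^sup>2))\<^sup>2))"
      by (rule Bochner_Integration.integral_sum) (use IY in auto)
    \<comment> \<open>\<open>Y j\<close> has second moment \<open>1 + \<sigma>\<^sup>2\<close>, one
      power of which cancels against the squared denominator.\<close>
    also have "\<dots> = (\<Sum>j<n. 1 / (1 + \<sigma>\<^sup>2))"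
      using moments_Y(3) one_plus_pos by (intro sum.cong) (auto simp: power_divide power2_eq_square)
    finally show ?thesis by simp
  qed
  have "vvar M n (\<lambda>\<omega>. sortvec n (\<lambda>i. X i \<omega>)) \<le> (\<Sum>i<n. expectation (\<lambda>\<omega>. (SX i \<omega> - ?g i \<omega>)\<^sup>2) + real n / (1 + \<sigma>\<^sup>2))"
    unfolding v by (rule sum_mono) (use pyth small in auto)
  then show "vvar M n (\<lambda>\<omega>. sortvec n (\<lambda>i. X i \<omega>)) - (real n)\<^sup>2 / (1 + \<sigma>\<^sup>2)
      \<le> mmse M n (\<lambda>\<omega>. sortvec n (\<lambda>i. X i \<omega>)) (\<lambda>\<omega>. sortvec n (\<lambda>i. Y i \<omega>))"
    unfolding m by (simp add: sum.distrib power2_eq_square)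
qed

end

text \<open>A single pair \<open>X\<close>, \<open>Z\<close> realizes the channel at every noise
  level, so the limit concerns a function of \<open>\<sigma>\<close> on one probability space. That
  the bound reduces to the variance inequality is expressed by convergence of the sorted error to
  the variance.\<close>

theorem theorem9:
  fixes M :: "'a measure" and n :: nat
    and X Z :: "nat \<Rightarrow> 'a \<Rightarrow> real"
  assumes "prob_space M"
    and "n \<ge> 1"
    and "prob_space.indep_vars M (\<lambda>_. borel)
           (\<lambda>k. case k of Inl i \<Rightarrow> X i | Inr i \<Rightarrow> Z i) (Inl ` {..<n} \<union> Inr ` {..<n})"
    and "\<forall>i<n. distributed M lborel (X i) (\<lambda>x. ennreal (std_normal_density x))"
    and "\<forall>i<n. distributed M lborel (Z i) (\<lambda>x. ennreal (std_normal_density x))"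
  defines "Xv \<equiv> (\<lambda>\<omega> i. X i \<omega>)"
    and "Yv \<equiv> (\<lambda>(\<sigma>::real) \<omega> i. X i \<omega> + \<sigma> * Z i \<omega>)"
  shows "(\<forall>\<sigma>>0. mmse M n Xv (Yv \<sigma>) = real n * \<sigma>\<^sup>2 / (1 + \<sigma>\<^sup>2)
              \<and> mmse M n (\<lambda>\<omega>. sortvec n (Xv \<omega>)) (\<lambda>\<omega>. sortvec n (Yv \<sigma> \<omega>))
                  \<ge> 1 / (fact n) powr (2 / real n) * mmse M n Xv (Yv \<sigma>))
       \<and> ((\<lambda>\<sigma>. mmse M n (\<lambda>\<omega>. sortvec n (Xv \<omega>)) (\<lambda>\<omega>. sortvec n (Yv \<sigma> \<omega>)))
            \<longlongrightarrow> vvar M n (\<lambda>\<omega>. sortvec n (Xv \<omega>))) at_top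
       \<and> vvar M n (\<lambda>\<omega>. sortvec n (Xv \<omega>))
           \<ge> real n / (2 * pi * exp 1) * exp (2 / real n * diff_entropy M n (\<lambda>\<omega>. sortvec n (Xv \<omega>)))
       \<and> real n / (2 * pi * exp 1) * exp (2 / real n * diff_entropy M n (\<lambda>\<omega>. sortvec n (Xv \<omega>)))
           = real n / (fact n) powr (2 / real n)"
proof -
  let ?mmse = "\<lambda>\<sigma>. mmse M n (\<lambda>\<omega>. sortvec n (Xv \<omega>)) (\<lambda>\<omega>. sortvec n (Yv \<sigma> \<omega>))"
  let ?var = "vvar M n (\<lambda>\<omega>. sortvec n (Xv \<omega>))"
  let ?q = "(fact n :: real) powr (2 / real n)"
  interpret prob_space M by fact
  have ch: "gaussian_channel M n X Z \<sigma>" if "\<sigma> > 0" for \<sigma>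
    using assms(2-5) that by unfold_locales auto
  have unsorted: "mmse M n Xv (Yv \<sigma>) = real n * \<sigma>\<^sup>2 / (1 + \<sigma>\<^sup>2)"
    and ge: "real n * (\<sigma>\<^sup>2 / (1 + \<sigma>\<^sup>2)) / ?q \<le> ?mmse \<sigma>"
    and le_var: "?mmse \<sigma> \<le> ?var"
    and var_le: "?var - (real n)\<^sup>2 / (1 + \<sigma>\<^sup>2) \<le> ?mmse \<sigma>" if "\<sigma> > 0" for \<sigma>
  proof -
    interpret gaussian_channel M n X Z \<sigma> by (rule ch[OF that])
    have Yv: "Yv \<sigma> = (\<lambda>\<omega> i. Y i \<omega>)" by (simp add: Yv_def Y_def)
    show "mmse M n Xv (Yv \<sigma>) = real n * \<sigma>\<^sup>2 / (1 + \<sigma>\<^sup>2)"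
      "real n * (\<sigma>\<^sup>2 / (1 + \<sigma>\<^sup>2)) / ?q \<le> ?mmse \<sigma>" "?mmse \<sigma> \<le> ?var"
      "?var - (real n)\<^sup>2 / (1 + \<sigma>\<^sup>2) \<le> ?mmse \<sigma>"
      unfolding Yv Xv_def
      using mmse_unsorted mmse_sorted_ge mmse_sorted_le_vvar vvar_le_mmse_sorted by (simp_all add: s_power2)
  qed
  have lim: "(?mmse \<longlongrightarrow> ?var) at_top"
  proof (rule tendsto_sandwich)
    show "\<forall>\<^sub>F \<sigma> in at_top. ?var - (real n)\<^sup>2 / (1 + \<sigma>\<^sup>2) \<le> ?mmse \<sigma>"
      "\<forall>\<^sub>F \<sigma> in at_top. ?mmse \<sigma> \<le> ?var"
      using var_le le_var by (auto intro: eventually_mono[OF eventually_gt_at_top[of 0]])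
    have "((\<lambda>\<sigma>::real. 1 / (1 + \<sigma>\<^sup>2)) \<longlongrightarrow> 0) at_top" by real_asymp
    then have "((\<lambda>\<sigma>::real. ?var - (real n)\<^sup>2 * (1 / (1 + \<sigma>\<^sup>2))) \<longlongrightarrow> ?var - (real n)\<^sup>2 * 0) at_top"
      by (intro tendsto_intros)
    then show "((\<lambda>\<sigma>::real. ?var - (real n)\<^sup>2 / (1 + \<sigma>\<^sup>2)) \<longlongrightarrow> ?var) at_top" by simp
  qed simp
  \<comment> \<open>The sorted error never exceeds the variance, so every finite-noise lower bound
    lies below the variance, and so does their limit.\<close>
  have "real n / ?q \<le> ?var"
  proof (rule tendsto_upperbound)
    show "\<forall>\<^sub>F \<sigma> in at_top. real n * (\<sigma>\<^sup>2 / (1 + \<sigma>\<^sup>2)) / ?q \<le> ?var"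
      using ge le_var by (auto intro!: eventually_mono[OF eventually_gt_at_top[of 0]] intro: order_trans)
    have "((\<lambda>\<sigma>::real. \<sigma>\<^sup>2 / (1 + \<sigma>\<^sup>2)) \<longlongrightarrow> 1) at_top" by real_asymp
    then have "((\<lambda>\<sigma>::real. real n * (\<sigma>\<^sup>2 / (1 + \<sigma>\<^sup>2)) / ?q) \<longlongrightarrow> real n * 1 / ?q) at_top"
      by (intro tendsto_intros) auto
    then show "((\<lambda>\<sigma>::real. real n * (\<sigma>\<^sup>2 / (1 + \<sigma>\<^sup>2)) / ?q) \<longlongrightarrow> real n / ?q) at_top" by simp
  qed simp
  moreover have ent: "real n / (2 * pi * exp 1) * exp (2 / real n * diff_entropy M n (\<lambda>\<omega>. sortvec n (Xv \<omega>))) = real n / ?q"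
  proof -
    \<comment> \<open>The entropy involves \<open>X\<close> alone; the noise level 1 is an arbitrary
      choice giving access to the facts about \<open>X\<close>.\<close>
    interpret gaussian_channel M n X Z 1 by (rule ch) simp
    have "diff_entropy M n (\<lambda>\<omega>. sortvec n (Xv \<omega>)) = real n / 2 * ln (2 * pi * exp 1) - ln (fact n)"
      unfolding Xv_def using indep_X n X moments_X(1,3) by (rule diff_entropy_sortvec_normal)
    then have "2 / real n * diff_entropy M n (\<lambda>\<omega>. sortvec n (Xv \<omega>)) = ln (2 * pi * exp 1) - 2 / real n * ln (fact n)"
      using n by (simp add: field_simps)
    then have "exp (2 / real n * diff_entropy M n (\<lambda>\<omega>. sortvec n (Xv \<omega>))) = 2 * pi * exp 1 / ?q"
      by (simp add: exp_diff powr_def)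
    then show ?thesis by simp
  qed
  moreover have "1 / ?q * mmse M n Xv (Yv \<sigma>) \<le> ?mmse \<sigma>" if "\<sigma> > 0" for \<sigma>
    using ge[OF that] unsorted[OF that] by (simp add: mult.commute)
  ultimately show ?thesis unfolding ent using unsorted lim by blast
qed

end
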